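(* Let $n\ge2$, $0<m<1/2$, and $$E_{2m} = \{ z \in \mathbb{C}^n : |z_1|^{2m} + |z_2|^2 + \cdots + |z_n|^2 < 1 \}.$$ For $z=(z_1,\ldots,z_n)\in E_{2m}$ write $\hat z=(z_2,\ldots,z_n)$ and $|\hat z|^2=|z_2|^2+\cdots+|z_n|^2$. Then the Wu metric on $E_{2m}$ at the point $z=(z_1,\ldots,z_n)$ is given by $$\sum_{i,j=1}^n h_{i\bar j}(z_1,\ldots,z_n)\,dz_i\otimes d\bar z_j,$$ where $$h_{1\bar1}(z)=\frac{(1-|\hat z|^2)^{1/m}}{\left((1-|\hat z|^2)^{1/m}-|z_1|^2\right)^2},$$ $$h_{1\bar j}(z)=\frac{(1-|\hat z|^2)^{-1+1/m}\,\bar z_1z_j}{m\left((1-|\hat z|^2)^{1/m}-|z_1|^2\right)^2}\quad\text{for }2\le j\le n,$$ $$h_{i\bar1}(z)=\overline{h_{1\bar i}(z)}\quad\text{for }2\le i\le n,$$ $$h_{j\bar j}(z)=\frac{(1-|\hat z|^2)^{-2+1/m}|z_1|^2|z_j|^2}{m^2\left((1-|\hat z|^2)^{1/m}-|z_1|^2\right)^2}+\frac{1-|\hat z|^2+|z_j|^2}{(1-|\hat z|^2)\,(1-|\hat z|^2-|z_1|^{2m})}\quad\text{for }2\le j\le n,$$ $$h_{i\bar j}(z)=\frac{(1-|\hat z|^2)^{-2+1/m}|z_1|^2\,\bar z_iz_j}{m^2\left((1-|\hat z|^2)^{1/m}-|z_1|^2\right)^2}+\frac{\bar z_iz_j}{(1-|\hat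 z|^2)\,(1-|\hat z|^2-|z_1|^{2m})}\quad\text{for }2\le i,j\le n,\ i\ne j.$$
   Context: Kobayashi metric: let $\mathbb{D}$ be the open unit disc in $\mathbb{C}$. For a domain $D\subset\mathbb{C}^n$, $z\in D$, $v\in\mathbb{C}^n$, $$K_D(z,v)=\inf\{ |\lambda| : \lambda \in\mathbb{C},\ \text{there is a holomorphic } f:\mathbb{D}\to D \text{ with } f(0)=z,\ \lambda f'(0)=v\}.$$ The Kobayashi indicatrix at $z$ is $\{v\in\mathbb{C}^n : K_D(z,v)<1\}$. Wu metric: for a bounded domain $D$ and $z\in D$, among all Hermitian inner products on $T_zD=\mathbb{C}^n$ whose open unit ball (a complex ellipsoid centred at $0$) contains the Kobayashi indicatrix at $z$, there is exactly one whose unit ball has the smallest volume. The Wu metric at $z$ is this inner product (with no further normalizing factor). Writing it as $\sum h_{i\bar j}\,dz_i\otimes d\bar z_j$ means that the squared norm of $v\in\mathbb{C}^n$ is $\sum h_{i\bar j}v_i\bar v_j$. *)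

theory Defs
  imports "HOL-Complex_Analysis.Complex_Analysis"
begin

definition holomorphic_disc :: "(complex ^ 'n) set \<Rightarrow> (complex \<Rightarrow> complex ^ 'n) \<Rightarrow> bool" where
  "holomorphic_disc D f \<longleftrightarrow>
     (\<forall>i. (\<lambda>\<zeta>. f \<zeta> $ i) holomorphic_on ball 0 1) \<and> f ` ball 0 1 \<subseteq> D"

definition disc_deriv :: "(complex \<Rightarrow> complex ^ 'n) \<Rightarrow> complex \<Rightarrow> complex ^ 'n" where
  "disc_deriv f \<zeta> = (\<chi> i. deriv (\<lambda>w. f w $ i) \<zeta>)"

definition kobayashi :: "(complex ^ 'n) set \<Rightarrow> complex ^ 'n \<Rightarrow> complex ^ 'n \<Rightarrow> real" where
  "kobayashi D z v =
     Inf {cmod l | l. \<exists>f. holomorphic_disc D f \<and> f 0 = z \<and> l *s disc_deriv f 0 = v}"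

definition kobayashi_indicatrix :: "(complex ^ 'n) set \<Rightarrow> complex ^ 'n \<Rightarrow> (complex ^ 'n) set" where
  "kobayashi_indicatrix D z = {v. kobayashi D z v < 1}"

(* Linear in the first argument, conjugate-linear in the second, so that the matrix h
   of g is given by g u v = (\<Sum>i. \<Sum>j. h i j * u $ i * cnj (v $ j)). *)
definition hermitian_inner_product :: "(complex ^ 'n \<Rightarrow> complex ^ 'n \<Rightarrow> complex) \<Rightarrow> bool" where
  "hermitian_inner_product g \<longleftrightarrow>
     (\<forall>u v w. g (u + v) w = g u w + g v w) \<and>
     (\<forall>c u v. g (c *s u) v = c * g u v) \<and>
     (\<forall>u v. g v u = cnj (g u v)) \<and>
     (\<forall>v. v \<noteq> 0 \<longrightarrow> 0 < Re (g v v))"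

definition unit_ball :: "(complex ^ 'n \<Rightarrow> complex ^ 'n \<Rightarrow> complex) \<Rightarrow> (complex ^ 'n) set" where
  "unit_ball g = {v. Re (g v v) < 1}"

definition admissible ::
  "(complex ^ 'n) set \<Rightarrow> complex ^ 'n \<Rightarrow> (complex ^ 'n \<Rightarrow> complex ^ 'n \<Rightarrow> complex) \<Rightarrow> bool" where
  "admissible D z g \<longleftrightarrow> hermitian_inner_product g \<and> kobayashi_indicatrix D z \<subseteq> unit_ball g"

definition volume_minimizing ::
  "(complex ^ 'n) set \<Rightarrow> complex ^ 'n \<Rightarrow> (complex ^ 'n \<Rightarrow> complex ^ 'n \<Rightarrow> complex) \<Rightarrow> bool" where
  "volume_minimizing D z g \<longleftrightarrow>
     admissible D z g \<and>
     (\<forall>g'. admissible D z g' \<longrightarrow> emeasure lborel (unit_ball g) \<le> emeasure lborel (unit_ball g'))"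

(* A predicate rather than a definite description: "g is the Wu metric of D at z" includes
   that the minimizer is unique, and no value is assigned where there is no unique one. *)
definition is_wu_metric ::
  "(complex ^ 'n) set \<Rightarrow> complex ^ 'n \<Rightarrow> (complex ^ 'n \<Rightarrow> complex ^ 'n \<Rightarrow> complex) \<Rightarrow> bool" where
  "is_wu_metric D z g \<longleftrightarrow>
     volume_minimizing D z g \<and> (\<forall>g'. volume_minimizing D z g' \<longrightarrow> g' = g)"

(* Below, the index k :: 'n plays the role of 1: z $ k is the coordinate z_1, and the
   remaining coordinates form the vector z-hat. *)
definition hat_norm_sq :: "'n \<Rightarrow> complex ^ 'n \<Rightarrow> real" where
  "hat_norm_sq k z = (\<Sum>j\<in>UNIV - {k}. (cmod (z $ j))\<^sup>2)"

(* The set E_{2m}; the parameter is m, not 2m. *)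
definition egg_domain :: "real \<Rightarrow> 'n \<Rightarrow> (complex ^ 'n) set" where
  "egg_domain m k = {z. cmod (z $ k) powr (2 * m) + hat_norm_sq k z < 1}"

definition wu_first_row :: "real \<Rightarrow> 'n \<Rightarrow> complex ^ 'n \<Rightarrow> 'n \<Rightarrow> complex" where
  "wu_first_row m k z j = (let s = 1 - hat_norm_sq k z in
     of_real (s powr (-1 + 1/m) / (m * (s powr (1/m) - (cmod (z $ k))\<^sup>2)\<^sup>2)) * cnj (z $ k) * z $ j)"

definition wu_coeff :: "real \<Rightarrow> 'n \<Rightarrow> complex ^ 'n \<Rightarrow> 'n \<Rightarrow> 'n \<Rightarrow> complex" where
  "wu_coeff m k z i j = (let s = 1 - hat_norm_sq k z; d = s powr (1/m) - (cmod (z $ k))\<^sup>2 in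
     if i = k \<and> j = k then of_real (s powr (1/m) / d\<^sup>2)
     else if i = k then wu_first_row m k z j
     else if j = k then cnj (wu_first_row m k z i)
     else if i = j then
       of_real (s powr (-2 + 1/m) * (cmod (z $ k))\<^sup>2 * (cmod (z $ j))\<^sup>2 / (m\<^sup>2 * d\<^sup>2)
         + (s + (cmod (z $ j))\<^sup>2) / (s * (s - cmod (z $ k) powr (2 * m))))
     else
       of_real (s powr (-2 + 1/m) * (cmod (z $ k))\<^sup>2 / (m\<^sup>2 * d\<^sup>2)) * cnj (z $ i) * z $ j
         + of_real (1 / (s * (s - cmod (z $ k) powr (2 * m)))) * cnj (z $ i) * z $ j)"

end

theory Submission
  imports Defs
begin

text \<open>
  Write \<open>s = 1 - |z-hat|\<^sup>2\<close>. The automorphism \<open>(w\<^sub>1, w) \<mapsto> (w\<^sub>1 (s / (1 - <w, z-hat>)\<^sup>2)^(1/(2m)), \<phi> w)\<close>,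
  with \<open>\<phi>\<close> the ball automorphism that sends \<open>z-hat\<close> to \<open>0\<close>, moves \<open>z\<close> to a point \<open>(p, 0)\<close>, where the claimed form
  is \<open>|v\<^sub>1|\<^sup>2 / (1 - |p|\<^sup>2)\<^sup>2 + |v-hat|\<^sup>2 / (1 - |p|^(2m))\<close>.

  The indicatrix lies in its ball: for a disc \<open>(f, F)\<close> through \<open>(p, 0)\<close>, factor \<open>f = B exp H\<close> with \<open>B\<close> a finite
  Blaschke product (after shrinking the disc). Then \<open>(exp (m H), F)\<close> maps into the unit ball, and the Schwarz-Pick
  lemma there, combined with \<open>|B'(0)| \<le> 1 - |B(0)|\<^sup>2\<close>, reduces the claim to a real inequality; this is where \<open>m < 1/2\<close> enters.

  Conversely, an orthonormal basis \<open>e\<^sub>j\<close> of the form consists of derivatives of analytic discs, so every admissible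
  form \<open>h\<close> has \<open>h(e\<^sub>j, e\<^sub>j) \<le> 1\<close>. With \<open>B\<close> the ball of \<open>g\<close>, and \<open>Q\<close>, \<open>Q'\<close> the quadratic forms of \<open>g\<close>, \<open>h\<close>, the
  integral of \<open>(1 - Q')\<^sub>+\<close> is a universal multiple of the volume of the ball of \<open>h\<close>, and it is at least the integral of
  \<open>1 - Q'\<close> over \<open>B\<close>, hence at least that of \<open>1 - Q\<close>, since the sign flips of the \<open>e\<^sub>j\<close> preserve Lebesgue measure.
\<close>

section \<open>Real inequalities\<close>

lemma powr_lt_one:
  fixes x a :: real
  assumes "0 \<le> x" "x < 1" "0 < a" shows "x powr a < 1"
  using powr_less_mono2[of a x 1] assms by simp

text \<open>The function x^a is concave, so its chords ending at 1 become less steep as the left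
  endpoint moves right. It is used with \<open>a = 2 * m\<close>, so \<open>a \<le> 1\<close> is
  where \<open>m < 1/2\<close> enters.\<close>

lemma powr_antimono_ratio:
  fixes p q a :: real
  assumes "0 \<le> p" "p \<le> q" "q < 1" "0 < a" "a \<le> 1"
  shows "(1 - q powr a) * (1 - p) \<le> (1 - q) * (1 - p powr a)"
proof (cases "p = 0")
  case True
  have "q powr 1 \<le> q powr a" using assms powr_mono'[of a 1 q] by auto
  then show ?thesis using True assms by simp
next
  case False
  define P where "P = p powr a"
  define Q where "Q = q powr a"
  have P: "0 < P" "P < 1" "P \<le> Q" "Q < 1"
    using False assms by (auto simp: P_def Q_def powr_mono2 powr_lt_one)
  \<comment> \<open>The chord inequality is read off from the convexity of the inverse function
    x^(1/a), with \<open>Q\<close> as a convex combination of 1 and \<open>P\<close>.\<close>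
  define c where "c = 1/a"
  have c: "c \<ge> 1" using assms by (simp add: c_def)
  have pc: "P powr c = p" "Q powr c = q" using assms False by (auto simp: P_def Q_def c_def powr_powr)
  define t where "t = (1 - Q) / (1 - P)"
  have t: "0 \<le> t" "t \<le> 1" using P by (auto simp: t_def divide_simps)
  have "t * (1 - P) = 1 - Q" using P by (simp add: t_def)
  then have Qt: "Q = (1 - t) * 1 + t * P" by (simp add: algebra_simps)
  have "Q powr c \<le> (1 - t) * (1 powr c) + t * (P powr c)"
    unfolding Qt using convex_onD[OF powr_convex[OF c], of t 1 P] t P by simp
  then have "t * (1 - p) \<le> 1 - q" using pc by (simp add: algebra_simps)
  then have "(1 - Q) * (1 - p) \<le> (1 - q) * (1 - P)" using P by (simp add: t_def field_simps)
  then show ?thesis by (simp add: P_def Q_def)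
qed

text \<open>With \<open>q = exp (-t)\<close> this is \<open>sinh (m t) \<le> m sinh t\<close>.\<close>

lemma powr_sinh_bound:
  fixes q m :: real
  assumes q: "0 < q" "q < 1" and m: "0 \<le> m" "m \<le> 1"
  shows "q powr (1 - m) - q powr (1 + m) \<le> m * (1 - q\<^sup>2)"
proof -
  \<comment> \<open>As a function of the exponent, \<open>D\<close> satisfies D'' = (ln q)^2 D \<ge>
    0 on [0, 1], so it lies below its chord from \<open>D 0 = 0\<close> to
    \<open>D 1 = 1 - q\<^sup>2\<close>.\<close>
  define D where "D = (\<lambda>x. q powr (1 - x) - q powr (1 + x))"
  have conv: "convex_on {0..1} D"
  proof (rule f''_ge0_imp_convex)
    show "convex {0..1::real}" by simp
    fix x :: real assume x: "x \<in> {0..1}"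
    show "(D has_real_derivative (- ln q * (q powr (1 - x) + q powr (1 + x)))) (at x)"
      unfolding D_def using q by (auto intro!: derivative_eq_intros simp: powr_def exp_add exp_diff algebra_simps)
    show "((\<lambda>x. - ln q * (q powr (1 - x) + q powr (1 + x))) has_real_derivative ((ln q)\<^sup>2 * D x)) (at x)"
      unfolding D_def using q by (auto intro!: derivative_eq_intros simp: powr_def power2_eq_square exp_add exp_diff algebra_simps)
    have "q powr (1 + x) \<le> q powr (1 - x)" using q x by (intro powr_mono') auto
    then show "(ln q)\<^sup>2 * D x \<ge> 0" by (simp add: D_def)
  qed
  have "D ((1 - m) *\<^sub>R 0 + m *\<^sub>R 1) \<le> (1 - m) * D 0 + m * D 1"
    using convex_onD[OF conv, of m 0 1] m by simp
  then show ?thesis using q by (simp add: D_def powr_add power2_eq_square)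
qed

text \<open>The left-hand side has the form \<open>(A + B t)\<^sup>2 + C (1 - t\<^sup>2)\<close> with \<open>C > B\<^sup>2\<close> unless \<open>b = 1\<close>, so its maximum over
  \<open>t\<close> is \<open>C + A\<^sup>2 C / (C - B\<^sup>2)\<close>.\<close>

lemma quadratic_blaschke_bound:
  fixes b q t :: real
  assumes b: "0 \<le> b" "b \<le> 1" and q: "0 \<le> q" "q < 1" and t: "0 \<le> t" "t \<le> 1"
  shows "((1 - b\<^sup>2) * q + b * t * (1 - q\<^sup>2))\<^sup>2 + (1 - q) * (1 - b * q) * (1 + b * q)\<^sup>2 * (1 - t\<^sup>2)
     \<le> (1 - b\<^sup>2 * q\<^sup>2)\<^sup>2"
proof (cases "b = 1")
  \<comment> \<open>For \<open>b = 1\<close> the left-hand side is independent of \<open>t\<close>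
    and equals the right-hand side. In the other case \<open>C - B\<^sup>2\<close> is positive and
    can be divided out.\<close>
  case True
  have "((1 - q\<^sup>2) * t)\<^sup>2 + (1 - q\<^sup>2)\<^sup>2 * (1 - t\<^sup>2) = (1 - q\<^sup>2)\<^sup>2" by algebra
  moreover have "(1 - q\<^sup>2)\<^sup>2 = (1 - q) * (1 - q) * (1 + q)\<^sup>2" by algebra
  ultimately show ?thesis using True by (simp add: mult.commute)
next
  case False
  then have b1: "b < 1" using b by simp
  have bq: "b * q \<le> q" "b * q \<le> b" "0 \<le> b * q" using b q by (auto simp: mult_left_le mult_left_le_one_le)
  define A where "A = (1 - b\<^sup>2) * q"
  define B where "B = b * (1 - q\<^sup>2)"
  define C where "C = (1 - q) * (1 - b * q) * (1 + b * q)\<^sup>2"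
  define N where "N = (1 - b\<^sup>2 * q\<^sup>2)\<^sup>2"
  have CB: "C - B\<^sup>2 = (1 - q) * ((1 - b) * (1 + b + b * q + b\<^sup>2 * q ^ 3))"
    unfolding B_def C_def by algebra
  have CBpos: "C - B\<^sup>2 > 0" unfolding CB using b1 b q bq by (intro mult_pos_pos add_pos_nonneg) auto
  have NC: "(1 - q) * (N - C) = C * (q * (1 - b))" unfolding N_def C_def by algebra
  have C0: "C > 0" proof -
    have "0 < 1 - b * q" "0 < 1 + b * q" using bq q by linarith+
    then show ?thesis unfolding C_def using q by simp
  qed
  \<comment> \<open>This is the discriminant inequality \<open>AC\<close> below with its common
    factors removed.\<close>
  have key: "(1 - b) * (1 + b)\<^sup>2 * q \<le> (1 - b) * (1 + b + b * q + b\<^sup>2 * q ^ 3)"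
  proof -
    have "b\<^sup>2 * q * (1 + q) \<le> 1 * 1 * (1 + b) "
    proof -
      have "b * q * (b * (1 + q)) \<le> 1 * (1 + b)"
        using b q bq by (intro mult_mono) (auto simp: algebra_simps)
      then show ?thesis by (simp add: power2_eq_square algebra_simps)
    qed
    then have "0 \<le> (1 - q) * ((1 + b) - b\<^sup>2 * q * (1 + q))" using q by simp
    then have "(1 + b)\<^sup>2 * q \<le> (1 + b + b * q + b\<^sup>2 * q ^ 3)"
      by (simp add: algebra_simps power2_eq_square power3_eq_cube)
    then show ?thesis using b1 by (simp add: mult.assoc mult_left_mono)
  qed
  have "A\<^sup>2 \<le> q * (1 - b) * ((1 - b) * (1 + b + b * q + b\<^sup>2 * q ^ 3))"
  proof -
    have "A\<^sup>2 = q * (1 - b) * ((1 - b) * (1 + b)\<^sup>2 * q)" unfolding A_def by algebra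
    also have "\<dots> \<le> q * (1 - b) * ((1 - b) * (1 + b + b * q + b\<^sup>2 * q ^ 3))"
      using key q b1 by (intro mult_left_mono) auto
    finally show ?thesis .
  qed
  then have "(1 - q) * (A\<^sup>2 * C) \<le> (1 - q) * (q * (1 - b) * ((1 - b) * (1 + b + b * q + b\<^sup>2 * q ^ 3)) * C)"
    using C0 q by (intro mult_left_mono mult_right_mono) auto
  also have "\<dots> = (C - B\<^sup>2) * (C * (q * (1 - b)))" unfolding CB by algebra
  also have "\<dots> = (1 - q) * ((C - B\<^sup>2) * (N - C))" by (simp only: NC[symmetric]) algebra
  finally have AC: "A\<^sup>2 * C \<le> (C - B\<^sup>2) * (N - C)" using q by simp
  \<comment> \<open>Completing the square in \<open>t\<close>, with vertex at A B / (C - B^2); what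
    remains is the discriminant \<open>AC\<close>.\<close>
  have "(C - B\<^sup>2) * (N - (A + B * t)\<^sup>2 - C * (1 - t\<^sup>2))
     = ((C - B\<^sup>2) * (N - C) - A\<^sup>2 * C) + ((C - B\<^sup>2) * t - A * B)\<^sup>2" by algebra
  also have "\<dots> \<ge> 0" using AC by simp
  finally have "0 \<le> N - (A + B * t)\<^sup>2 - C * (1 - t\<^sup>2)" using CBpos by (simp add: zero_le_mult_iff)
  then show ?thesis unfolding A_def B_def C_def N_def by (simp add: algebra_simps)
qed

text \<open>For a disc (B exp H, F), the letters stand for \<open>b\<close> = |B(0)|,
  \<open>q\<close> = |exp H(0)|, \<open>\<eta>\<close> = |H'(0)|, \<open>d\<close> = |(B exp H)'(0)|
  and \<open>Y\<close> = |F'(0)|^2. The bound on \<open>d\<close> is the product rule with |B'(0)|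
  \<le> 1 - b^2, and the bound on \<open>Y\<close> is Schwarz-Pick for (exp (m H), F).\<close>

lemma egg_scalar_bound:
  fixes m b q \<eta> d Y :: real
  assumes m: "0 < m" "m < 1/2" and b: "0 \<le> b" "b \<le> 1" and q: "0 < q" "q < 1"
    and eta: "0 \<le> \<eta>" and d: "0 \<le> d" "d \<le> (1 - b\<^sup>2) * q + b * q * \<eta>"
    and Y: "m\<^sup>2 * \<eta>\<^sup>2 * q powr (2 * m) + (1 - q powr (2 * m)) * Y \<le> (1 - q powr (2 * m))\<^sup>2" "0 \<le> Y"
  shows "d\<^sup>2 / (1 - (b * q)\<^sup>2)\<^sup>2 + Y / (1 - (b * q) powr (2 * m)) \<le> 1"
proof -
  define Q where "Q = q powr (2 * m)"
  define P where "P = (b * q) powr (2 * m)"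
  have bq: "b * q \<le> q" "0 \<le> b * q" using b q by (auto simp: mult_left_le_one_le)
  have Q: "0 < Q" "Q < 1" using q m by (auto simp: Q_def powr_lt_one)
  have P: "P < 1" "0 \<le> P" using q m bq by (auto simp: P_def powr_lt_one powr_mono2 intro!: le_less_trans[OF _ Q(2)[unfolded Q_def]])
  \<comment> \<open>\<open>t\<close> is |u'(0)| / (1 - |u(0)|^2) for u = exp (m H). In terms of it,
    the hypothesis on \<open>Y\<close> becomes
    \<open>Y \<le> (1 - Q) * (1 - t\<^sup>2)\<close>.\<close>
  define t where "t = m * \<eta> * q powr m / (1 - Q)"
  have t2: "t\<^sup>2 * (1 - Q)\<^sup>2 = m\<^sup>2 * \<eta>\<^sup>2 * Q"
  proof -
    have "(q powr m)\<^sup>2 = Q" using q by (simp add: Q_def power2_eq_square flip: powr_add)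
    then show ?thesis using Q by (simp add: t_def power_divide power_mult_distrib)
  qed
  have "t\<^sup>2 * (1 - Q)\<^sup>2 + (1 - Q) * Y \<le> (1 - Q)\<^sup>2" using Y t2 by (simp add: Q_def)
  then have "(1 - Q) * Y \<le> (1 - Q) * ((1 - Q) * (1 - t\<^sup>2))" by (simp add: algebra_simps power2_eq_square)
  then have Yt: "Y \<le> (1 - Q) * (1 - t\<^sup>2)" using Q by simp
  then have "0 \<le> (1 - Q) * (1 - t\<^sup>2)" using Y by linarith
  then have "t\<^sup>2 \<le> 1" using Q by (simp add: zero_le_mult_iff)
  moreover have t0: "0 \<le> t" using m eta Q by (simp add: t_def)
  ultimately have t1: "t \<le> 1" using power2_le_imp_le[of t 1] by simp
  \<comment> \<open>The same quotient formed with exp H instead of exp (m H) is at most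
    \<open>t\<close>.\<close>
  have "q * \<eta> \<le> t * (1 - q\<^sup>2)"
  proof -
    have "q powr (1 - m) - q powr (1 + m) \<le> m * (1 - q\<^sup>2)"
      by (rule powr_sinh_bound) (use q m in auto)
    then have "\<eta> * q powr m * (q powr (1 - m) - q powr (1 + m)) \<le> \<eta> * q powr m * (m * (1 - q\<^sup>2))"
      using eta by (intro mult_left_mono) auto
    moreover have "q powr m * (q powr (1 - m) - q powr (1 + m)) = q * (1 - Q)"
      using q by (simp add: Q_def right_diff_distrib flip: powr_add) (simp add: powr_add algebra_simps flip: mult_2)
    ultimately have "\<eta> * (q * (1 - Q)) \<le> \<eta> * q powr m * (m * (1 - q\<^sup>2))" by (simp only: mult.assoc)
    then have "q * \<eta> * (1 - Q) \<le> m * \<eta> * q powr m * (1 - q\<^sup>2)" by (simp only: mult_ac)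
    then show ?thesis using Q by (simp add: t_def field_simps)
  qed
  then have "b * (q * \<eta>) \<le> b * (t * (1 - q\<^sup>2))" using b by (intro mult_left_mono) auto
  then have d2: "d \<le> (1 - b\<^sup>2) * q + b * t * (1 - q\<^sup>2)" using d by (simp add: algebra_simps)
  \<comment> \<open>This trades (1 - Q) / (1 - P) for (1 - q) / (1 - b q), which removes the
    exponent \<open>2 * m\<close> and leaves an inequality in \<open>b\<close>, \<open>q\<close> and
    \<open>t\<close> alone.\<close>
  have ratio: "(1 - Q) * (1 - b * q) \<le> (1 - q) * (1 - P)"
    unfolding Q_def P_def by (rule powr_antimono_ratio) (use bq q m in auto)
  define N where "N = (1 - b * q)\<^sup>2 * (1 + b * q)\<^sup>2"
  define K where "K = (1 - q) * (1 - b * q) * (1 + b * q)\<^sup>2 * (1 - t\<^sup>2)"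
  have "Y / (1 - P) \<le> (1 - q) / (1 - b * q) * (1 - t\<^sup>2)"
  proof -
    have "Y * (1 - b * q) \<le> (1 - Q) * (1 - t\<^sup>2) * (1 - b * q)"
    proof (rule mult_right_mono[OF Yt])
      show "0 \<le> 1 - b * q" using bq(1) q by linarith
    qed
    also have "\<dots> = ((1 - Q) * (1 - b * q)) * (1 - t\<^sup>2)" by algebra
    also have "\<dots> \<le> ((1 - q) * (1 - P)) * (1 - t\<^sup>2)" using ratio \<open>t\<^sup>2 \<le> 1\<close> by (intro mult_right_mono) auto
    finally have *: "Y * (1 - b * q) \<le> ((1 - q) * (1 - P)) * (1 - t\<^sup>2)" .
    have "y / E \<le> x / D * T" if "y * D \<le> x * E * T" "0 < D" "0 < E" for x y D E T :: real
      using that by (simp add: field_simps)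
    moreover have "0 < 1 - P" "0 < 1 - b * q" using P bq q by linarith+
    ultimately show ?thesis using * by blast
  qed
  moreover have "d\<^sup>2 \<le> ((1 - b\<^sup>2) * q + b * t * (1 - q\<^sup>2))\<^sup>2" using d2 d by (intro power_mono)
  then have "d\<^sup>2 + (1 - q) * (1 - b * q) * (1 + b * q)\<^sup>2 * (1 - t\<^sup>2) \<le> (1 - b\<^sup>2 * q\<^sup>2)\<^sup>2"
    using quadratic_blaschke_bound[of b q t] b q t0 t1 by simp
  moreover have "(1 - b\<^sup>2 * q\<^sup>2)\<^sup>2 = (1 - b * q)\<^sup>2 * (1 + b * q)\<^sup>2" by algebra
  moreover have "(1 - q) / (1 - b * q) * (1 - t\<^sup>2) = (1 - q) * (1 - b * q) * (1 + b * q)\<^sup>2 * (1 - t\<^sup>2) / ((1 - b * q)\<^sup>2 * (1 + b * q)\<^sup>2)"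
    using bq q by (auto simp: power2_eq_square)
  moreover have "(1 - b * q)\<^sup>2 * (1 + b * q)\<^sup>2 > 0"
  proof -
    have "0 < 1 - b * q" "0 < 1 + b * q" using bq q by linarith+
    then show ?thesis by simp
  qed
  ultimately have Y1: "Y / (1 - P) \<le> K / N" and "d\<^sup>2 + K \<le> N" and N: "0 < N"
    by (simp_all add: K_def N_def)
  then have "(d\<^sup>2 + K) / N \<le> 1" by simp
  then have "d\<^sup>2 / N + Y / (1 - P) \<le> 1" using Y1 by (simp add: add_divide_distrib)
  moreover have "N = (1 - (b * q)\<^sup>2)\<^sup>2" unfolding N_def by algebra
  ultimately show ?thesis by (simp add: P_def)
qed

section \<open>Schwarz-Pick estimates and Blaschke factors\<close>

lemma deriv_le_of_sphere_bound:
  assumes "G holomorphic_on ball 0 1" "continuous_on (cball 0 1) G"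
    and "\<And>x. cmod x = 1 \<Longrightarrow> cmod (G x) \<le> B"
  shows "cmod (deriv G 0) \<le> B"
  using Cauchy_inequality[of G 0 1 B 1] assms by simp

lemma cauchy_schwarz_sum_complex:
  fixes a b :: "'i \<Rightarrow> complex"
  assumes "finite I"
  shows "(cmod (\<Sum>i\<in>I. a i * b i))\<^sup>2 \<le> (\<Sum>i\<in>I. (cmod (a i))\<^sup>2) * (\<Sum>i\<in>I. (cmod (b i))\<^sup>2)"
proof -
  have "cmod (\<Sum>i\<in>I. a i * b i) \<le> (\<Sum>i\<in>I. \<bar>cmod (a i)\<bar> * \<bar>cmod (b i)\<bar>)"
    by (rule order_trans[OF norm_sum]) (simp add: norm_mult)
  also have "\<dots> \<le> L2_set (\<lambda>i. cmod (a i)) I * L2_set (\<lambda>i. cmod (b i)) I"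
    by (rule L2_set_mult_ineq)
  finally have "(cmod (\<Sum>i\<in>I. a i * b i))\<^sup>2 \<le> (L2_set (\<lambda>i. cmod (a i)) I * L2_set (\<lambda>i. cmod (b i)) I)\<^sup>2"
    by (intro power_mono) auto
  then show ?thesis
    by (simp add: power_mult_distrib L2_set_def sum_nonneg)
qed

lemma ball_automorphism_norm:
  fixes u c :: complex
  shows "(cmod (1 - cnj c * u))\<^sup>2 - (cmod (u - c))\<^sup>2 = (1 - (cmod c)\<^sup>2) * (1 - (cmod u)\<^sup>2)"
  by (simp only: cmod_power2) (simp add: power2_eq_square algebra_simps)

text \<open>A ball automorphism moves (u 0, 0) to 0; Cauchy's estimate on the closed disc then
  bounds the derivative. Pairing the map with its own derivative turns the vector estimate into a
  scalar one.\<close>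

lemma schwarz_pick_ball:
  fixes u :: "complex \<Rightarrow> complex" and F :: "'i \<Rightarrow> complex \<Rightarrow> complex"
  assumes I: "finite I"
    and u: "u holomorphic_on ball 0 1" "continuous_on (cball 0 1) u"
    and F: "\<And>i. i \<in> I \<Longrightarrow> F i holomorphic_on ball 0 1" "\<And>i. i \<in> I \<Longrightarrow> continuous_on (cball 0 1) (F i)"
      "\<And>i. i \<in> I \<Longrightarrow> F i 0 = 0"
    and sph: "\<And>x. cmod x = 1 \<Longrightarrow> (cmod (u x))\<^sup>2 + (\<Sum>i\<in>I. (cmod (F i x))\<^sup>2) < 1"
  shows "cmod (u 0) < 1"
    and "(cmod (deriv u 0))\<^sup>2 + (1 - (cmod (u 0))\<^sup>2) * (\<Sum>i\<in>I. (cmod (deriv (F i) 0))\<^sup>2)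
      \<le> (1 - (cmod (u 0))\<^sup>2)\<^sup>2"
proof -
  have u1: "cmod (u x) < 1" if "cmod x = 1" for x
  proof -
    have "(cmod (u x))\<^sup>2 < 1\<^sup>2"
      using sph[OF that] sum_nonneg[of I "\<lambda>i. (cmod (F i x))\<^sup>2"] by simp
    then show ?thesis by (rule power_less_imp_less_base) simp
  qed
  \<comment> \<open>The maximum over the circle is attained, hence still below 1, and the maximum
    modulus principle carries this strict bound to the whole disc.\<close>
  have "\<exists>y\<in>sphere 0 1. \<forall>x\<in>sphere 0 1. cmod (u x) \<le> cmod (u y)"
    by (rule continuous_attains_sup)
       (auto intro!: continuous_intros continuous_on_subset[OF u(2)])
  then obtain y where y: "cmod y = 1" "\<And>x. cmod x = 1 \<Longrightarrow> cmod (u x) \<le> cmod (u y)" by auto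
  have ule: "cmod (u x) \<le> cmod (u y)" if "x \<in> cball 0 1" for x
    by (rule maximum_modulus_frontier[of u "cball 0 1"]) (use that u y in \<open>auto simp: sphere_def\<close>)
  have ult: "cmod (u x) < 1" if "x \<in> cball 0 1" for x
    using ule[OF that] u1[OF y(1)] by simp
  define c where "c = u 0"
  show c1: "cmod (u 0) < 1" using ult by simp
  define \<kappa> where "\<kappa> = 1 - (cmod c)\<^sup>2"
  have \<kappa>: "0 < \<kappa>" using c1 by (simp add: \<kappa>_def c_def power_less_one_iff abs_square_less_1)
  have den: "1 - cnj c * u x \<noteq> 0" if "x \<in> cball 0 1" for x
  proof
    assume "1 - cnj c * u x = 0"
    then have "cmod (cnj c * u x) = 1" by simp
    moreover have "cmod (cnj c * u x) \<le> cmod c * 1"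
      unfolding norm_mult using ult[OF that] by (intro mult_mono) auto
    ultimately show False using c1 c_def by simp
  qed
  define S where "S = (\<Sum>i\<in>I. (cmod (deriv (F i) 0))\<^sup>2)"
  define T where "T = (cmod (deriv u 0))\<^sup>2 + \<kappa> * S"
  have S0: "0 \<le> S" by (simp add: S_def sum_nonneg)
  have T0: "0 \<le> T" using S0 \<kappa> by (simp add: T_def)
  \<comment> \<open>\<open>G\<close> pairs the ball automorphism sending \<open>(c, 0)\<close> to \<open>0\<close> with the scaled derivative of the disc\<close>
  define N where "N = (\<lambda>x. cnj (deriv u 0) * (u x - c) + of_real \<kappa> * (\<Sum>i\<in>I. cnj (deriv (F i) 0) * F i x))"
  define G where "G = (\<lambda>x. N x / (1 - cnj c * u x))"
  have "cmod (deriv G 0) \<le> sqrt T"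
  proof (rule deriv_le_of_sphere_bound)
    show "G holomorphic_on ball 0 1"
      unfolding G_def N_def using den by (intro holomorphic_intros u F) auto
    show "continuous_on (cball 0 1) G"
      unfolding G_def N_def using den by (intro continuous_intros u F) auto
    fix x :: complex assume x: "cmod x = 1"
    define W where "W = (\<Sum>i\<in>I. (cmod (F i x))\<^sup>2)"
    define V where "V = (\<Sum>i\<in>I. cnj (deriv (F i) 0) * F i x)"
    have V: "(cmod V)\<^sup>2 \<le> S * W"
      using cauchy_schwarz_sum_complex[OF I, of "\<lambda>i. cnj (deriv (F i) 0)" "\<lambda>i. F i x"]
      by (simp add: V_def S_def W_def)
    have "W \<ge> 0" by (simp add: W_def sum_nonneg)
    have "cmod (N x) \<le> cmod (deriv u 0) * cmod (u x - c) + \<kappa> * cmod V"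
      unfolding N_def V_def[symmetric] using \<kappa> by (rule_tac order_trans[OF norm_triangle_ineq]) (simp add: norm_mult)
    also have "\<dots> \<le> cmod (deriv u 0) * cmod (u x - c) + \<kappa> * (sqrt S * sqrt W)"
    proof -
      have "cmod V \<le> sqrt S * sqrt W"
        using V by (simp add: real_le_rsqrt flip: real_sqrt_mult)
      then show ?thesis using \<kappa> by simp
    qed
    \<comment> \<open>Cauchy-Schwarz for two terms, the second with weight
      \<open>\<kappa>\<close>.\<close>
    also have "\<dots> \<le> sqrt T * sqrt ((cmod (u x - c))\<^sup>2 + \<kappa> * W)"
    proof -
      have "(cmod (deriv u 0) * cmod (u x - c) + \<kappa> * (sqrt S * sqrt W))\<^sup>2
          \<le> T * ((cmod (u x - c))\<^sup>2 + \<kappa> * W)"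
      proof -
        define A where "A = cmod (deriv u 0)"
        define B where "B = cmod (u x - c)"
        define s where "s = sqrt S"
        define w where "w = sqrt W"
        have sw: "S = s\<^sup>2" "W = w\<^sup>2" using S0 \<open>W \<ge> 0\<close> by (auto simp: s_def w_def)
        have "(A\<^sup>2 + \<kappa> * s\<^sup>2) * (B\<^sup>2 + \<kappa> * w\<^sup>2) - (A * B + \<kappa> * (s * w))\<^sup>2 = \<kappa> * (A * w - B * s)\<^sup>2"
          by algebra
        moreover have "0 \<le> \<kappa> * (A * w - B * s)\<^sup>2" using \<kappa> by simp
        ultimately have "(A * B + \<kappa> * (s * w))\<^sup>2 \<le> (A\<^sup>2 + \<kappa> * S) * (B\<^sup>2 + \<kappa> * W)" unfolding sw by linarith
        then show ?thesis by (simp only: T_def A_def B_def s_def w_def)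
      qed
      then show ?thesis by (metis real_le_rsqrt real_sqrt_mult)
    qed
    also have "\<dots> \<le> sqrt T * cmod (1 - cnj c * u x)"
    proof -
      have "(cmod (u x - c))\<^sup>2 + \<kappa> * W \<le> (cmod (1 - cnj c * u x))\<^sup>2"
      proof -
        have "\<kappa> * W \<le> \<kappa> * (1 - (cmod (u x))\<^sup>2)"
          using sph[OF x] \<kappa> by (intro mult_left_mono) (auto simp: W_def)
        then show ?thesis using ball_automorphism_norm[of c "u x"] by (simp add: \<kappa>_def)
      qed
      then show ?thesis using T0 by (intro mult_left_mono real_le_lsqrt) auto
    qed
    finally have "cmod (N x) \<le> sqrt T * cmod (1 - cnj c * u x)" .
    moreover have "0 < cmod (1 - cnj c * u x)" using den[of x] x by simp
    ultimately show "cmod (G x) \<le> sqrt T" by (simp add: G_def norm_divide divide_le_eq)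
  qed
  \<comment> \<open>\<open>T\<close> is the pairing of the derivative with itself, and
    \<open>N 0 = 0\<close> removes the derivative of the denominator. The bound
    \<open>T / \<kappa> \<le> sqrt T\<close> is then equivalent to the claim
    \<open>T \<le> \<kappa>\<^sup>2\<close>.\<close>
  moreover have "deriv G 0 = of_real (T / \<kappa>)"
  proof -
    have du: "(u has_field_derivative deriv u 0) (at 0)"
      using u by (intro holomorphic_derivI[of _ "ball 0 1"]) auto
    have dF: "(F i has_field_derivative deriv (F i) 0) (at 0)" if "i \<in> I" for i
      using F that by (intro holomorphic_derivI[of _ "ball 0 1"]) auto
    have dN: "(N has_field_derivative of_real T) (at 0)"
    proof -
      have "(N has_field_derivative cnj (deriv u 0) * deriv u 0 + of_real \<kappa> * (\<Sum>i\<in>I. cnj (deriv (F i) 0) * deriv (F i) 0)) (at 0)"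
        unfolding N_def by (auto intro!: derivative_eq_intros du dF sum.cong simp: mult.commute)
      moreover have "cnj (deriv u 0) * deriv u 0 + of_real \<kappa> * (\<Sum>i\<in>I. cnj (deriv (F i) 0) * deriv (F i) 0) = of_real T"
      proof -
        have *: "cnj x * x = of_real ((cmod x)\<^sup>2)" for x
          by (simp add: complex_norm_square mult.commute del: of_real_power)
        show ?thesis unfolding T_def S_def * by simp
      qed
      ultimately show ?thesis by simp
    qed
    have N0: "N 0 = 0" using F by (simp add: N_def c_def)
    have d0: "1 - cnj c * u 0 = of_real \<kappa>"
      by (simp add: \<kappa>_def c_def complex_norm_square mult.commute del: of_real_power)
    have "(G has_field_derivative of_real T / of_real \<kappa>) (at 0)"
      unfolding G_def using \<kappa> by (auto intro!: derivative_eq_intros du dN simp: N0 d0)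
    then show ?thesis by (simp add: DERIV_imp_deriv)
  qed
  ultimately have "T / \<kappa> \<le> sqrt T" using T0 \<kappa> by (simp add: norm_divide)
  then have "(T / \<kappa>)\<^sup>2 \<le> T"
    using T0 \<kappa> by (metis divide_nonneg_pos power_mono real_sqrt_pow2)
  then have "T * T \<le> T * \<kappa>\<^sup>2" using \<kappa> by (simp add: field_simps power2_eq_square)
  then have "T \<le> \<kappa>\<^sup>2" using T0 by (cases "T = 0") auto
  then show "(cmod (deriv u 0))\<^sup>2 + (1 - (cmod (u 0))\<^sup>2) * (\<Sum>i\<in>I. (cmod (deriv (F i) 0))\<^sup>2)
      \<le> (1 - (cmod (u 0))\<^sup>2)\<^sup>2"
    by (simp add: T_def S_def \<kappa>_def c_def)
qed

section \<open>Finite Blaschke products and their factorization\<close>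

text \<open>The last condition holds for every holomorphic self-map of the disc; making it part of the definition
  lets it be propagated through products.\<close>

definition disc_inner :: "(complex \<Rightarrow> complex) \<Rightarrow> bool" where
  "disc_inner B \<longleftrightarrow> B holomorphic_on ball 0 1 \<and> continuous_on (cball 0 1) B \<and>
     (\<forall>x. cmod x = 1 \<longrightarrow> cmod (B x) = 1) \<and> cmod (deriv B 0) \<le> 1 - (cmod (B 0))\<^sup>2"

lemma disc_inner_one: "disc_inner (\<lambda>x. 1)"
  by (simp add: disc_inner_def)

text \<open>The product rule bounds the derivative by (a + b)(1 - a b), and a + b \<le> 1 + a b
  because (1 - a)(1 - b) \<ge> 0.\<close>

lemma disc_inner_mult:
  assumes "disc_inner A" "disc_inner B" shows "disc_inner (\<lambda>x. A x * B x)"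
proof -
  define a b where "a = cmod (A 0)" and "b = cmod (B 0)"
  have a: "cmod (deriv A 0) \<le> 1 - a\<^sup>2" and b: "cmod (deriv B 0) \<le> 1 - b\<^sup>2"
    using assms by (auto simp: disc_inner_def a_def b_def)
  have "0 \<le> 1 - a\<^sup>2" "0 \<le> 1 - b\<^sup>2" using a b norm_ge_zero order_trans by blast+
  then have a1: "0 \<le> a" "a \<le> 1" and b1: "0 \<le> b" "b \<le> 1"
    by (auto simp: a_def b_def abs_square_le_1)
  have "A field_differentiable at 0" "B field_differentiable at 0"
    using assms unfolding disc_inner_def
    by (auto intro!: holomorphic_on_imp_differentiable_at[of _ "ball 0 1"])
  then have "cmod (deriv (\<lambda>x. A x * B x) 0) \<le> cmod (A 0 * deriv B 0) + cmod (deriv A 0 * B 0)"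
    by (simp add: norm_triangle_ineq)
  also have "\<dots> \<le> a * (1 - b\<^sup>2) + (1 - a\<^sup>2) * b"
    using a b a1 b1 by (auto simp: norm_mult a_def b_def intro!: add_mono mult_left_mono mult_right_mono)
  also have "\<dots> = (a + b) * (1 - a * b)" by algebra
  also have "\<dots> \<le> (1 + a * b) * (1 - a * b)"
  proof (rule mult_right_mono)
    have "0 \<le> (1 - a) * (1 - b)" using a1 b1 by simp
    then show "a + b \<le> 1 + a * b" by (simp add: algebra_simps)
    show "0 \<le> 1 - a * b" using a1 b1 by (simp add: mult_le_one)
  qed
  also have "\<dots> = 1 - (a * b)\<^sup>2" by algebra
  finally show ?thesis
    using assms unfolding disc_inner_def a_def b_def
    by (auto intro!: holomorphic_intros continuous_intros simp: norm_mult)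
qed

text \<open>In the right half-plane the denominator of a Blaschke factor is nonzero and has a
  holomorphic principal logarithm.\<close>

lemma one_minus_cnj_mult_Re_pos:
  assumes "cmod a < 1" "cmod x \<le> 1" shows "Re (1 - cnj a * x) > 0"
proof -
  have "Re (cnj a * x) \<le> cmod (cnj a * x)" by (rule complex_Re_le_cmod)
  also have "\<dots> \<le> cmod a * 1" unfolding norm_mult using assms by (intro mult_mono) auto
  finally show ?thesis using assms by simp
qed

text \<open>A single factor attains equality in the derivative bound: it has value
  \<open>- a\<close> and derivative 1 - |a|^2 at 0.\<close>

lemma disc_inner_moebius:
  assumes a: "cmod a < 1"
  shows "disc_inner (\<lambda>x. (x - a) / (1 - cnj a * x))"
proof -
  have den: "1 - cnj a * x \<noteq> 0" if "cmod x \<le> 1" for x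
    using one_minus_cnj_mult_Re_pos[OF a that] by force
  have "((\<lambda>x. (x - a) / (1 - cnj a * x)) has_field_derivative (1 - a * cnj a)) (at 0)"
    by (auto intro!: derivative_eq_intros simp: algebra_simps)
  then have "deriv (\<lambda>x. (x - a) / (1 - cnj a * x)) 0 = of_real (1 - (cmod a)\<^sup>2)"
    by (simp add: DERIV_imp_deriv complex_norm_square del: of_real_power)
  then have "cmod (deriv (\<lambda>x. (x - a) / (1 - cnj a * x)) 0) = 1 - (cmod a)\<^sup>2"
    using a by (simp only: norm_of_real) (simp add: abs_square_le_1 less_imp_le)
  moreover have "cmod ((x - a) / (1 - cnj a * x)) = 1" if "cmod x = 1" for x
  proof -
    have "(cmod (1 - cnj a * x))\<^sup>2 = (cmod (x - a))\<^sup>2"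
      using ball_automorphism_norm[of a x] that by simp
    then have "cmod (1 - cnj a * x) = cmod (x - a)" by (simp add: power2_eq_iff_nonneg)
    moreover have "cmod (1 - cnj a * x) \<noteq> 0" using den[of x] that by simp
    ultimately show ?thesis by (simp only: norm_divide) simp
  qed
  ultimately show ?thesis
    unfolding disc_inner_def using den
    by (auto intro!: holomorphic_intros continuous_intros)
qed

lemma disc_inner_power:
  assumes "disc_inner A" shows "disc_inner (\<lambda>x. A x ^ n)"
proof (induction n)
  case 0 then show ?case by (simp add: disc_inner_one)
next
  case (Suc n) then show ?case using disc_inner_mult[OF assms Suc] by simp
qed

text \<open>The quotient of \<open>f\<close> by (w - a)^n is holomorphic away from \<open>a\<close>
  and agrees near \<open>a\<close> with the local factor \<open>zor_poly f a\<close>, so its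
  singularity is removable and the local factorization becomes global.\<close>

lemma holomorphic_factor_zero:
  assumes f: "f holomorphic_on S" "open S" "connected S" "a \<in> S" and ne: "\<exists>w\<in>S. f w \<noteq> 0"
  obtains g n where "g holomorphic_on S" "g a \<noteq> 0" "\<And>w. w \<in> S \<Longrightarrow> f w = (w - a) ^ n * g w"
proof -
  define n where "n = nat (zorder f a)"
  define g0 where "g0 = zor_poly f a"
  obtain r where r: "r > 0" "cball a r \<subseteq> S" "g0 holomorphic_on cball a r"
    "\<And>w. w \<in> cball a r \<Longrightarrow> f w = g0 w * (w - a) ^ n \<and> g0 w \<noteq> 0"
    using zorder_exist_zero[OF f ne] unfolding n_def g0_def by blast
  define g where "g = (\<lambda>w. if w = a then g0 a else f w / (w - a) ^ n)"
  have gg: "g w = g0 w" if "w \<in> cball a r" for w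
    using r(4)[OF that] by (auto simp: g_def)
  show thesis
  proof
    show "g holomorphic_on S"
    proof (rule no_isolated_singularity')
      show "g holomorphic_on S - {a}"
      proof (rule holomorphic_transform)
        show "(\<lambda>w. f w / (w - a) ^ n) holomorphic_on S - {a}"
          by (intro holomorphic_intros holomorphic_on_subset[OF f(1)]) auto
      qed (auto simp: g_def)
      fix w assume "w \<in> {a}"
      then have w: "w = a" by simp
      have "isCont g0 a"
        using r by (intro continuous_on_interior[OF holomorphic_on_imp_continuous_on[OF r(3)]]) simp
      then have "(g0 \<longlongrightarrow> g a) (at a within S)"
        using r(1) by (simp add: isCont_def gg Lim_at_imp_Lim_at_within)
      moreover have "\<forall>\<^sub>F x in at a within S. g0 x = g x"
        using r(1) gg by (auto simp: eventually_at dist_commute intro!: exI[of _ r])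
      ultimately show "(g \<longlongrightarrow> g w) (at w within S)"
        unfolding w by (rule Lim_transform_eventually)
    qed (use f in auto)
    show "g a \<noteq> 0" using r(1) r(4)[of a] by (simp add: g_def)
    fix w assume "w \<in> S"
    show "f w = (w - a) ^ n * g w"
      using r(4)[of a] r(1) by (auto simp: g_def)
  qed
qed

text \<open>Induction on the number of distinct zeros. A zero \<open>a\<close> of multiplicity
  \<open>n\<close> is removed at once: (w - a)^n is the Blaschke factor to the power
  \<open>n\<close> times (1 - cnj a w)^n, and the latter goes into the exponent through
  \<open>Ln\<close>. Without zeros, \<open>f\<close> has a logarithm on the larger ball, continuous
  on the closed unit disc as \<open>1 < R\<close>.\<close>

lemma blaschke_factorization:
  assumes "1 < R" "f holomorphic_on ball 0 R" "\<exists>w\<in>ball 0 R. f w \<noteq> 0"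
    and "finite {w\<in>ball 0 R. f w = 0}" "{w\<in>ball 0 R. f w = 0} \<subseteq> ball 0 1"
  obtains B H where "disc_inner B" "H holomorphic_on ball 0 1" "continuous_on (cball 0 1) H"
    "\<And>w. cmod w \<le> 1 \<Longrightarrow> f w = B w * exp (H w)"
proof -
  have "\<exists>B H. disc_inner B \<and> H holomorphic_on ball 0 1 \<and> continuous_on (cball 0 1) H \<and>
    (\<forall>w. cmod w \<le> 1 \<longrightarrow> f w = B w * exp (H w))"
    using assms
  proof (induction "card {w\<in>ball 0 R. f w = 0}" arbitrary: f)
    case 0
    then have "f w \<noteq> 0" if "w \<in> ball 0 R" for w using that by auto
    then obtain H where H: "H holomorphic_on ball 0 R" "\<And>x. x \<in> ball 0 R \<Longrightarrow> exp (H x) = f x"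
      using holomorphic_logarithm_exists[of "ball 0 R" f 0] 0 by auto
    moreover have "ball 0 1 \<subseteq> ball (0::complex) R" "cball 0 1 \<subseteq> ball (0::complex) R" using \<open>1 < R\<close> by auto
    ultimately show ?case
      using \<open>1 < R\<close> by (intro exI[of _ "\<lambda>x. 1"] exI[of _ H])
        (auto simp: disc_inner_one intro: holomorphic_on_subset continuous_on_subset[OF holomorphic_on_imp_continuous_on])
  next
    case (Suc k)
    then have "{w\<in>ball 0 R. f w = 0} \<noteq> {}" by (metis card.empty nat.distinct(1))
    then obtain a where a: "a \<in> ball 0 R" "f a = 0" by auto
    then have a1: "cmod a < 1" using Suc.prems by auto
    obtain g n where g: "g holomorphic_on ball 0 R" "g a \<noteq> 0"
      "\<And>w. w \<in> ball 0 R \<Longrightarrow> f w = (w - a) ^ n * g w"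
      using holomorphic_factor_zero[of f "ball 0 R" a] Suc.prems a by auto
    have n0: "n \<noteq> 0" using g a by (metis mult_1 power_0)
    have Z: "{w\<in>ball 0 R. g w = 0} = {w\<in>ball 0 R. f w = 0} - {a}"
      using g n0 by auto
    obtain B H where BH: "disc_inner B" "H holomorphic_on ball 0 1" "continuous_on (cball 0 1) H"
      "\<And>w. cmod w \<le> 1 \<Longrightarrow> g w = B w * exp (H w)"
    proof -
      have "k = card {w\<in>ball 0 R. g w = 0}"
        unfolding Z using Suc.hyps(2) Suc.prems(4) a by (simp add: card_Diff_singleton)
      moreover have "finite {w\<in>ball 0 R. g w = 0}" "{w\<in>ball 0 R. g w = 0} \<subseteq> ball 0 1"
        unfolding Z using Suc.prems by auto
      moreover have "\<exists>w\<in>ball 0 R. g w \<noteq> 0" using a(1) g(2) by blast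
      ultimately show thesis using Suc.hyps(1)[of g] \<open>1 < R\<close> g(1) that by blast
    qed
    have Ln: "1 - cnj a * w \<notin> \<real>\<^sub>\<le>\<^sub>0" if "cmod w \<le> 1" for w
      using one_minus_cnj_mult_Re_pos[OF a1 that] by (auto simp: complex_nonpos_Reals_iff)
    show ?case
    proof (intro exI conjI allI impI)
      show "disc_inner (\<lambda>x. ((x - a) / (1 - cnj a * x)) ^ n * B x)"
        using disc_inner_mult[OF disc_inner_power[OF disc_inner_moebius[OF a1]] BH(1)] by simp
      show "(\<lambda>x. of_nat n * Ln (1 - cnj a * x) + H x) holomorphic_on ball 0 1"
        using Ln by (intro holomorphic_intros BH) auto
      show "continuous_on (cball 0 1) (\<lambda>x. of_nat n * Ln (1 - cnj a * x) + H x)"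
        using Ln by (intro continuous_intros BH) auto
      fix w :: complex assume w: "cmod w \<le> 1"
      have nz: "1 - cnj a * w \<noteq> 0" using Ln[OF w] by auto
      have "f w = (w - a) ^ n * (B w * exp (H w))"
        using g(3)[of w] w \<open>1 < R\<close> BH(4)[OF w] by simp
      also have "\<dots> = ((w - a) / (1 - cnj a * w)) ^ n * B w * exp (of_nat n * Ln (1 - cnj a * w) + H w)"
        using nz by (simp add: exp_add exp_of_nat_mult power_divide)
      finally show "f w = ((w - a) / (1 - cnj a * w)) ^ n * B w * exp (of_nat n * Ln (1 - cnj a * w) + H w)" .
    qed
  qed
  then show thesis using that by blast
qed

section \<open>Discs in the egg domain\<close>

text \<open>With f = B exp H, the modulus of \<open>B\<close> is 1 on the circle, so u = exp (m H)
  satisfies |u|^2 = |f|^(2m) there. Thus (u, F) maps the circle into the unit ball, Schwarz-Pick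
  applies, and \<open>egg_scalar_bound\<close> finishes.\<close>

lemma egg_disc_bound_closed:
  fixes f :: "complex \<Rightarrow> complex" and F :: "'i \<Rightarrow> complex \<Rightarrow> complex"
  assumes m: "0 < m" "m < 1/2" and I: "finite I" and R: "1 < R"
    and f: "f holomorphic_on ball 0 R" "\<exists>w\<in>ball 0 R. f w \<noteq> 0" "{w\<in>ball 0 R. f w = 0} \<subseteq> ball 0 1"
    and F: "\<And>i. i \<in> I \<Longrightarrow> F i holomorphic_on ball 0 R" "\<And>i. i \<in> I \<Longrightarrow> F i 0 = 0"
    and sph: "\<And>x. cmod x = 1 \<Longrightarrow> cmod (f x) powr (2 * m) + (\<Sum>i\<in>I. (cmod (F i x))\<^sup>2) < 1"
  shows "(cmod (deriv f 0))\<^sup>2 / (1 - (cmod (f 0))\<^sup>2)\<^sup>2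
       + (\<Sum>i\<in>I. (cmod (deriv (F i) 0))\<^sup>2) / (1 - cmod (f 0) powr (2 * m)) \<le> 1"
proof -
  have sub: "ball 0 1 \<subseteq> ball (0::complex) R" "cball 0 1 \<subseteq> ball (0::complex) R" using R by auto
  \<comment> \<open>The zeros lie in the compact closed unit disc, so they are finite in number
    unless \<open>f\<close> is constant, and then it is a nonzero constant.\<close>
  have fin: "finite {w\<in>ball 0 R. f w = 0}"
  proof (cases "f constant_on ball 0 R")
    case True
    then have "{w\<in>ball 0 R. f w = 0} = {}" using f(2) by (auto simp: constant_on_def)
    then show ?thesis by (metis finite.emptyI)
  next
    case False
    have "finite {w\<in>cball 0 1. f w = 0}"
      by (rule holomorphic_compact_finite_zeros[OF f(1)]) (use False sub in auto)
    then show ?thesis by (rule rev_finite_subset) (use f(3) in auto)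
  qed
  obtain B H where B: "disc_inner B" and H: "H holomorphic_on ball 0 1" "continuous_on (cball 0 1) H"
    and fBH: "\<And>w. cmod w \<le> 1 \<Longrightarrow> f w = B w * exp (H w)"
    using blaschke_factorization[OF R f(1,2) fin f(3)] by blast
  define u where "u = (\<lambda>x. exp (of_real m * H x))"
  define h where "h = (\<lambda>x. cmod (exp (H x)))"
  have nu: "(cmod (u x))\<^sup>2 = h x powr (2 * m)" for x
    by (simp add: u_def h_def powr_def norm_exp_eq_Re exp_of_nat_mult[symmetric] power2_eq_square flip: exp_add)
  have Fh: "F i holomorphic_on ball 0 1" "continuous_on (cball 0 1) (F i)" if "i \<in> I" for i
    using F(1)[OF that] sub by (auto intro: holomorphic_on_subset continuous_on_subset[OF holomorphic_on_imp_continuous_on])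
  have uh: "u holomorphic_on ball 0 1" "continuous_on (cball 0 1) u"
    unfolding u_def by (auto intro!: holomorphic_intros continuous_intros H)
  have sph': "(cmod (u x))\<^sup>2 + (\<Sum>i\<in>I. (cmod (F i x))\<^sup>2) < 1" if "cmod x = 1" for x
  proof -
    have "cmod (f x) = h x" using fBH[of x] B that by (simp add: disc_inner_def h_def norm_mult)
    then show ?thesis using sph[OF that] nu by simp
  qed
  define q where "q = h 0"
  define b where "b = cmod (B 0)"
  define \<eta> where "\<eta> = cmod (deriv H 0)"
  define Y where "Y = (\<Sum>i\<in>I. (cmod (deriv (F i) 0))\<^sup>2)"
  have q0: "0 < q" by (simp add: q_def h_def)
  have dH: "(H has_field_derivative deriv H 0) (at 0)"
    using H by (intro holomorphic_derivI[of _ "ball 0 1"]) auto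
  have dB: "(B has_field_derivative deriv B 0) (at 0)"
    using B unfolding disc_inner_def by (intro holomorphic_derivI[of _ "ball 0 1"]) auto
  have b1: "cmod (deriv B 0) \<le> 1 - b\<^sup>2" "0 \<le> b" using B by (auto simp: disc_inner_def b_def)
  then have "0 \<le> 1 - b\<^sup>2" using norm_ge_zero order_trans by blast
  then have b2: "b \<le> 1" by (simp add: b_def abs_square_le_1)
  have ub: "cmod (u 0) < 1" and
    uY: "(cmod (deriv u 0))\<^sup>2 + (1 - (cmod (u 0))\<^sup>2) * Y \<le> (1 - (cmod (u 0))\<^sup>2)\<^sup>2"
    using schwarz_pick_ball[OF I uh Fh F(2) sph'] unfolding Y_def by auto
  have du: "deriv u 0 = u 0 * (of_real m * deriv H 0)"
    unfolding u_def by (rule DERIV_imp_deriv) (auto intro!: derivative_eq_intros dH)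
  have Q: "(cmod (u 0))\<^sup>2 = q powr (2 * m)" unfolding nu q_def ..
  have "q powr (2 * m) < 1" using ub unfolding Q[symmetric] by (simp add: abs_square_less_1)
  then have q1: "q < 1" using m q0 by (metis ge_one_powr_ge_zero linorder_not_less mult_nonneg_nonneg less_imp_le zero_le_numeral)
  have YY: "m\<^sup>2 * \<eta>\<^sup>2 * q powr (2 * m) + (1 - q powr (2 * m)) * Y \<le> (1 - q powr (2 * m))\<^sup>2"
  proof -
    have "(cmod (deriv u 0))\<^sup>2 = m\<^sup>2 * \<eta>\<^sup>2 * q powr (2 * m)"
      unfolding du norm_mult power_mult_distrib Q \<eta>_def by simp
    then show ?thesis using uY unfolding Q by simp
  qed
  have f0: "cmod (f 0) = b * q" using fBH[of 0] by (simp add: b_def q_def h_def norm_mult)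
  have df: "deriv f 0 = deriv B 0 * exp (H 0) + B 0 * (exp (H 0) * deriv H 0)"
  proof (rule DERIV_imp_deriv)
    have "((\<lambda>x. B x * exp (H x)) has_field_derivative deriv B 0 * exp (H 0) + B 0 * (exp (H 0) * deriv H 0)) (at 0)"
      by (auto intro!: derivative_eq_intros dB dH)
    then show "(f has_field_derivative deriv B 0 * exp (H 0) + B 0 * (exp (H 0) * deriv H 0)) (at 0)"
      by (rule DERIV_cong_ev[THEN iffD1, rotated -1])
         (auto simp: eventually_nhds fBH intro!: exI[of _ "ball 0 1"])
  qed
  have "cmod (deriv f 0) \<le> (1 - b\<^sup>2) * q + b * q * \<eta>"
  proof -
    have "cmod (deriv f 0) \<le> cmod (deriv B 0) * q + b * q * \<eta>"
      unfolding df by (rule order_trans[OF norm_triangle_ineq]) (simp add: norm_mult q_def h_def b_def \<eta>_def)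
    also have "cmod (deriv B 0) * q \<le> (1 - b\<^sup>2) * q" using b1 q0 by (intro mult_right_mono) auto
    finally show ?thesis by simp
  qed
  then show ?thesis
    unfolding f0 Y_def[symmetric]
    by (intro egg_scalar_bound[where \<eta> = \<eta>] m b1 b2 q0 q1 YY)
       (auto simp: \<eta>_def Y_def sum_nonneg)
qed

lemma deriv_scale_zero:
  fixes g :: "complex \<Rightarrow> complex"
  assumes "g field_differentiable at 0"
  shows "deriv (\<lambda>x. g (c * x)) 0 = c * deriv g 0"
proof (rule DERIV_imp_deriv)
  have "(g has_field_derivative deriv g 0) (at (c * 0))"
    using assms by (simp add: DERIV_deriv_iff_field_differentiable)
  moreover have "((\<lambda>x. c * x) has_field_derivative c) (at 0)"
    by (auto intro!: derivative_eq_intros)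
  ultimately show "((\<lambda>x. g (c * x)) has_field_derivative c * deriv g 0) (at 0)"
    using DERIV_chain2[of g "deriv g 0" "\<lambda>x. c * x" 0 c UNIV] by (simp add: mult.commute)
qed

text \<open>The closed version applies to the disc restricted to radius \<open>r\<close> whenever an
  annulus just outside contains no zeros of \<open>f\<close>; it gives the bound with the factor
  r^2. Such \<open>r\<close> exist arbitrarily close to 1.\<close>

lemma egg_disc_bound:
  fixes f :: "complex \<Rightarrow> complex" and F :: "'i \<Rightarrow> complex \<Rightarrow> complex"
  assumes m: "0 < m" "m < 1/2" and I: "finite I"
    and f: "f holomorphic_on ball 0 1"
    and F: "\<And>i. i \<in> I \<Longrightarrow> F i holomorphic_on ball 0 1" "\<And>i. i \<in> I \<Longrightarrow> F i 0 = 0"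
    and egg: "\<And>x. cmod x < 1 \<Longrightarrow> cmod (f x) powr (2 * m) + (\<Sum>i\<in>I. (cmod (F i x))\<^sup>2) < 1"
  shows "(cmod (deriv f 0))\<^sup>2 / (1 - (cmod (f 0))\<^sup>2)\<^sup>2
       + (\<Sum>i\<in>I. (cmod (deriv (F i) 0))\<^sup>2) / (1 - cmod (f 0) powr (2 * m)) \<le> 1" (is "?L \<le> 1")
proof -
  have scale: "r\<^sup>2 * ?L \<le> 1" if r: "0 < r" "r < t" "t \<le> 1"
    and nz: "\<And>w. r \<le> cmod w \<Longrightarrow> cmod w < t \<Longrightarrow> f w \<noteq> 0" for r t
  proof -
    define R where "R = t / r"
    have R: "1 < R" using r by (simp add: R_def)
    have Rr: "r * cmod x < t" if "cmod x < R" for x using that r by (simp add: R_def field_simps)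
    have maps: "(\<lambda>x. of_real r * x) ` ball 0 R \<subseteq> ball (0::complex) 1"
      using r Rr by (force simp: norm_mult)
    have hol: "(\<lambda>x. g (of_real r * x)) holomorphic_on ball 0 R" if "g holomorphic_on ball 0 1" for g
      using holomorphic_on_compose_gen[of "\<lambda>x. of_real r * x" "ball 0 R" g "ball 0 1"] that maps
      by (auto simp: o_def intro!: holomorphic_intros)
    have der: "deriv (\<lambda>x. g (of_real r * x)) 0 = of_real r * deriv g 0" if "g holomorphic_on ball 0 1" for g
      using that by (intro deriv_scale_zero holomorphic_on_imp_differentiable_at[of _ "ball 0 1"]) auto
    have "(cmod (deriv (\<lambda>x. f (of_real r * x)) 0))\<^sup>2 / (1 - (cmod (f (of_real r * 0)))\<^sup>2)\<^sup>2
       + (\<Sum>i\<in>I. (cmod (deriv (\<lambda>x. F i (of_real r * x)) 0))\<^sup>2) / (1 - cmod (f (of_real r * 0)) powr (2 * m)) \<le> 1"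
    proof (rule egg_disc_bound_closed[OF m I R])
      show "\<exists>w\<in>ball 0 R. f (of_real r * w) \<noteq> 0"
        using nz[of "of_real r"] r R by (intro bexI[of _ 1]) auto
      show "{w \<in> ball 0 R. f (of_real r * w) = 0} \<subseteq> ball 0 1"
      proof clarify
        fix w assume w: "w \<in> ball 0 R" "f (of_real r * w) = 0"
        then have "\<not> r \<le> cmod (of_real r * w)" using nz[of "of_real r * w"] Rr[of w] r by (auto simp: norm_mult)
        then show "w \<in> ball 0 1" using r by (auto simp: norm_mult)
      qed
      show "cmod (f (of_real r * x)) powr (2 * m) + (\<Sum>i\<in>I. (cmod (F i (of_real r * x)))\<^sup>2) < 1"
        if "cmod x = 1" for x
        by (rule egg) (use that r in \<open>auto simp: norm_mult\<close>)
    qed (use f F hol in auto)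
    then have "(r * cmod (deriv f 0))\<^sup>2 / (1 - (cmod (f 0))\<^sup>2)\<^sup>2
       + (\<Sum>i\<in>I. (r * cmod (deriv (F i) 0))\<^sup>2) / (1 - cmod (f 0) powr (2 * m)) \<le> 1"
      using der f F r by (simp add: norm_mult)
    then show ?thesis
      by (simp add: power_mult_distrib algebra_simps flip: sum_distrib_left)
  qed
  have "\<exists>r>r0. r < 1 \<and> r\<^sup>2 * ?L \<le> 1" if r0: "0 < r0" "r0 < 1" for r0
  proof (cases "\<exists>w\<in>ball 0 1. f w \<noteq> 0")
    case True
    define t1 where "t1 = (r0 + 1) / 2"
    have t1: "r0 < t1" "t1 < 1" using r0 by (auto simp: t1_def)
    define Z where "Z = {w\<in>cball 0 t1. f w = 0}"
    have "finite Z"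
    proof (cases "f constant_on ball 0 1")
      case True
      then have "Z = {}" using \<open>\<exists>w\<in>ball 0 1. f w \<noteq> 0\<close> t1 by (fastforce simp: Z_def constant_on_def)
      then show ?thesis by simp
    next
      case False
      then show ?thesis unfolding Z_def
        by (intro holomorphic_compact_finite_zeros[OF f]) (use t1 in auto)
    qed
    \<comment> \<open>\<open>M\<close> is \<open>r0\<close> or the largest modulus of a zero below
      \<open>t1\<close>, if that is larger. No zero lies strictly between the radii \<open>M\<close>
      and \<open>t1\<close>, so \<open>scale\<close> applies to their midpoint.\<close>
    define M where "M = Max (insert r0 {cmod w |w. w \<in> Z \<and> cmod w < t1})"
    have finM: "finite (insert r0 {cmod w |w. w \<in> Z \<and> cmod w < t1})" using \<open>finite Z\<close> by simp
    have "M \<in> insert r0 {cmod w |w. w \<in> Z \<and> cmod w < t1}" unfolding M_def by (rule Max_in[OF finM]) auto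
    then have M: "M < t1" using t1 by auto
    have M0: "r0 \<le> M" unfolding M_def using finM by simp
    define r where "r = (M + t1) / 2"
    have r: "M < r" "r < t1" using M by (auto simp: r_def)
    have "f w \<noteq> 0" if "r \<le> cmod w" "cmod w < t1" for w
    proof
      assume "f w = 0"
      then have "cmod w \<le> M" unfolding M_def using that finM by (intro Max_ge) (auto simp: Z_def)
      then show False using that r by simp
    qed
    then have "r\<^sup>2 * ?L \<le> 1" using r M0 r0 t1 by (intro scale[of r t1]) auto
    then show ?thesis using r M0 t1 by (intro exI[of _ r]) auto
  next
    case False
    \<comment> \<open>If \<open>f\<close> vanishes identically, there is no Blaschke factorization,
      but \<open>F\<close> alone maps into the unit ball and Schwarz-Pick with first component 0
      gives the bound.\<close>
    have f0: "f w = 0" if "cmod w < 1" for w using False that by auto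
    have df: "deriv f 0 = 0"
      using complex_derivative_transform_within_open[OF f holomorphic_on_const[of 0], of 0] f0 by auto
    define r where "r = (r0 + 1) / 2"
    have r: "r0 < r" "r < 1" "0 < r" using r0 by (auto simp: r_def)
    have maps: "(\<lambda>x. of_real r * x) ` cball 0 1 \<subseteq> ball (0::complex) 1"
    proof clarify
      fix x :: complex assume "x \<in> cball 0 1"
      then have "r * cmod x \<le> r * 1" using r by (intro mult_left_mono) auto
      then have "r * cmod x < 1" using r by linarith
      then show "of_real r * x \<in> ball 0 1" using r by (simp add: norm_mult)
    qed
    have hol: "(\<lambda>x. g (of_real r * x)) holomorphic_on ball 0 1" "continuous_on (cball 0 1) (\<lambda>x. g (of_real r * x))"
      if "g holomorphic_on ball 0 1" for g
      using holomorphic_on_compose_gen[of "\<lambda>x. of_real r * x" "ball 0 1" g "ball 0 1"] that maps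
        continuous_on_compose2[OF holomorphic_on_imp_continuous_on[OF that], of "cball 0 1" "\<lambda>x. of_real r * x"]
      by (auto simp: o_def image_subset_iff intro!: holomorphic_intros continuous_intros)
    have der: "deriv (\<lambda>x. g (of_real r * x)) 0 = of_real r * deriv g 0" if "g holomorphic_on ball 0 1" for g
      using that by (intro deriv_scale_zero holomorphic_on_imp_differentiable_at[of _ "ball 0 1"]) auto
    have "(cmod (deriv (\<lambda>x. 0) 0))\<^sup>2 + (1 - (cmod 0)\<^sup>2) * (\<Sum>i\<in>I. (cmod (deriv (\<lambda>x. F i (of_real r * x)) 0))\<^sup>2)
      \<le> (1 - (cmod 0)\<^sup>2)\<^sup>2"
    proof (rule schwarz_pick_ball(2)[OF I, of "\<lambda>x. 0"])
      fix x :: complex assume "cmod x = 1"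
      then have "cmod (of_real r * x) < 1" using r by (simp add: norm_mult)
      from egg[OF this] f0[OF this]
      show "(cmod 0)\<^sup>2 + (\<Sum>i\<in>I. (cmod (F i (of_real r * x)))\<^sup>2) < 1" by simp
    qed (use F hol in auto)
    then have "r\<^sup>2 * ?L \<le> 1"
      using der F r f0[of 0] df by (simp add: norm_mult power_mult_distrib flip: sum_distrib_left)
    then show ?thesis using r by blast
  qed note ex = this
  have L: "0 \<le> ?L"
  proof -
    have "0 \<le> (\<Sum>i\<in>I. (cmod (deriv (F i) 0))\<^sup>2)" by (simp add: sum_nonneg)
    moreover have "0 \<le> 1 - cmod (f 0) powr (2 * m)"
      using egg[of 0] sum_nonneg[of I "\<lambda>i. (cmod (F i 0))\<^sup>2"] by simp
    ultimately show ?thesis by simp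
  qed
  show ?thesis
  proof (rule ccontr)
    assume "\<not> ?L \<le> 1"
    then have L1: "1 < ?L" by simp
    \<comment> \<open>The limit r -> 1 in contrapositive form: \<open>r0\<close> is the radius at
      which r^2 times the left-hand side equals 1.\<close>
    define r0 where "r0 = 1 / sqrt ?L"
    have r0: "0 < r0" "r0 < 1" using L1 by (auto simp: r0_def)
    obtain r where r: "r0 < r" "r\<^sup>2 * ?L \<le> 1" using ex[OF r0] by blast
    have "r0\<^sup>2 * ?L = 1" using L1 by (simp add: r0_def power_divide)
    moreover have "r0\<^sup>2 * ?L < r\<^sup>2 * ?L" using r r0 L1 by (intro mult_strict_right_mono power_strict_mono) auto
    ultimately show False using r by simp
  qed
qed

section \<open>Quadratic forms and Lebesgue measure\<close>

lemma nn_integral_lborel_translate: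
  fixes f :: "'a::euclidean_space \<Rightarrow> ennreal"
  assumes [measurable]: "f \<in> borel_measurable borel"
  shows "(\<integral>\<^sup>+x. f (a + x) \<partial>lborel) = (\<integral>\<^sup>+x. f x \<partial>lborel)"
proof -
  have "(\<integral>\<^sup>+x. f x \<partial>lborel) = (\<integral>\<^sup>+x. f x \<partial>distr lborel borel ((+) a))" by (simp add: lborel_distr_plus)
  also have "\<dots> = (\<integral>\<^sup>+x. f (a + x) \<partial>lborel)" by (simp add: nn_integral_distr)
  finally show ?thesis ..
qed

lemma nn_integral_lborel_reflect:
  fixes f :: "'a::euclidean_space \<Rightarrow> ennreal"
  assumes [measurable]: "f \<in> borel_measurable borel"
  shows "(\<integral>\<^sup>+x. f (a - x) \<partial>lborel) = (\<integral>\<^sup>+x. f x \<partial>lborel)"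
proof -
  have "(\<integral>\<^sup>+x. f x \<partial>lborel) = (\<integral>\<^sup>+x. f x \<partial>density (distr lborel borel (\<lambda>x. a + (-1) *\<^sub>R x)) (\<lambda>_. ennreal (\<bar>-1\<bar>^DIM('a))))"
    by (subst lborel_affine[of "-1" a]) simp_all
  also have "\<dots> = (\<integral>\<^sup>+x. f (a - x) \<partial>lborel)" by (simp add: nn_integral_distr density_1)
  finally show ?thesis ..
qed

text \<open>The image measure is translation invariant, hence a multiple of Lebesgue measure; the
  \<open>R\<close>-invariant set \<open>S\<close> of finite positive measure forces the factor to be
  1, without a determinant.\<close>

lemma lborel_distr_linear_involution:
  fixes R :: "'a::euclidean_space \<Rightarrow> 'a"
  assumes lin: "linear R" and inv: "\<And>x. R (R x) = x"
    and S[measurable]: "S \<in> sets borel" and RS: "\<And>x. R x \<in> S \<longleftrightarrow> x \<in> S"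
    and S0: "emeasure lborel S \<noteq> 0" and Sfin: "emeasure lborel S \<noteq> \<infinity>"
  shows "distr lborel borel R = lborel"
proof (rule measure_eqI)
  have [measurable]: "R \<in> borel_measurable borel"
    using lin by (intro borel_measurable_continuous_onI linear_continuous_on) (simp add: linear_conv_bounded_linear)
  show "sets (distr lborel borel R) = sets lborel" by simp
  fix A assume "A \<in> sets (distr lborel borel R)"
  then have [measurable]: "A \<in> sets borel" by simp
  \<comment> \<open>uniqueness of Haar measure: evaluate the integral of \<open>f (R x) g (R x + y)\<close> in both orders\<close>
  define f :: "'a \<Rightarrow> ennreal" where "f = indicator A"
  define g :: "'a \<Rightarrow> ennreal" where "g = indicator S"
  have [measurable]: "f \<in> borel_measurable borel" "g \<in> borel_measurable borel" by (auto simp: f_def g_def)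
  have "(\<integral>\<^sup>+x. f (R x) \<partial>lborel) * emeasure lborel S = (\<integral>\<^sup>+x. (\<integral>\<^sup>+y. f (R x) * g (R x + y) \<partial>lborel) \<partial>lborel)"
    by (simp add: nn_integral_cmult nn_integral_lborel_translate nn_integral_multc) (simp add: g_def)
  also have "\<dots> = (\<integral>\<^sup>+y. (\<integral>\<^sup>+x. f (R x) * g (R x + y) \<partial>lborel) \<partial>lborel)"
    by (rule lborel_pair.Fubini') simp
  \<comment> \<open>Translating \<open>x\<close> by \<open>- R y\<close> moves the shift from
    \<open>g\<close> to \<open>f\<close>, because R (- R y + x) = R x - y.\<close>
  also have "\<dots> = (\<integral>\<^sup>+y. (\<integral>\<^sup>+x. f (R x - y) * g (R x) \<partial>lborel) \<partial>lborel)"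
  proof (rule nn_integral_cong)
    fix y :: 'a
    have "R (- R y + x) = R x - y" for x
      using lin inv by (simp add: linear_diff)
    then show "(\<integral>\<^sup>+x. f (R x) * g (R x + y) \<partial>lborel) = (\<integral>\<^sup>+x. f (R x - y) * g (R x) \<partial>lborel)"
      using nn_integral_lborel_translate[of "\<lambda>x. f (R x) * g (R x + y)" "- R y"] by simp
  qed
  also have "\<dots> = (\<integral>\<^sup>+x. (\<integral>\<^sup>+y. f (R x - y) * g (R x) \<partial>lborel) \<partial>lborel)"
    by (rule lborel_pair.Fubini'[symmetric]) simp
  also have "\<dots> = (\<integral>\<^sup>+x. f x \<partial>lborel) * (\<integral>\<^sup>+x. g (R x) \<partial>lborel)"
    by (simp add: nn_integral_multc nn_integral_lborel_reflect nn_integral_cmult)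
  also have "(\<integral>\<^sup>+x. g (R x) \<partial>lborel) = emeasure lborel S"
    using RS by (simp add: g_def indicator_def cong: nn_integral_cong) (simp flip: indicator_def)
  finally have "(\<integral>\<^sup>+x. f (R x) \<partial>lborel) = (\<integral>\<^sup>+x. f x \<partial>lborel)"
    using S0 Sfin by (simp add: mult.commute[of _ "emeasure lborel S"] ennreal_mult_cancel_left)
  then show "emeasure (distr lborel borel R) A = emeasure lborel A"
    by (simp add: f_def nn_integral_distr[symmetric, where f = "indicator A" and T = R and M = lborel and M' = borel])
qed

section \<open>Volumes of sublevel sets of quadratic forms\<close>

lemma emeasure_lborel_sublevel_scale:
  fixes Q :: "'a::euclidean_space \<Rightarrow> real"
  assumes [measurable]: "Q \<in> borel_measurable borel" and hom: "\<And>r v. Q (r *\<^sub>R v) = r\<^sup>2 * Q v" and s: "0 < s"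
  shows "emeasure lborel {v. Q v < s} = ennreal (sqrt s ^ DIM('a)) * emeasure lborel {v. Q v < 1}"
proof -
  have "emeasure lborel {v. Q v < s} = emeasure (density (distr lborel borel (\<lambda>x. 0 + sqrt s *\<^sub>R x)) (\<lambda>_. \<bar>sqrt s\<bar>^DIM('a))) {v. Q v < s}"
    using s by (subst lborel_affine[of "sqrt s" 0]) simp_all
  also have "\<dots> = ennreal (sqrt s ^ DIM('a)) * emeasure (distr lborel borel (\<lambda>x. sqrt s *\<^sub>R x)) {v. Q v < s}"
    using s by (subst emeasure_density_const) auto
  also have "emeasure (distr lborel borel (\<lambda>x. sqrt s *\<^sub>R x)) {v. Q v < s} = emeasure lborel {v. Q v < 1}"
    using s by (subst emeasure_distr) (auto simp: hom vimage_def)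
  finally show ?thesis .
qed

text \<open>Layer-cake formula: the positive part of 1 - Q v is the length of the interval from Q v
  to 1. After exchanging the integrals, each layer is a scaled copy of the unit sublevel set, so the
  factor depends only on the dimension.\<close>

lemma nn_integral_one_minus_quadratic:
  fixes Q :: "'a::euclidean_space \<Rightarrow> real"
  assumes [measurable]: "Q \<in> borel_measurable borel" and hom: "\<And>r v. Q (r *\<^sub>R v) = r\<^sup>2 * Q v" and nn: "\<And>v. 0 \<le> Q v"
  shows "(\<integral>\<^sup>+v. ennreal (max 0 (1 - Q v)) \<partial>lborel)
    = (\<integral>\<^sup>+s. ennreal (indicator {0<..<1} s * sqrt s ^ DIM('a)) \<partial>lborel) * emeasure lborel {v. Q v < 1}"
proof -
  have "(\<integral>\<^sup>+v. ennreal (max 0 (1 - Q v)) \<partial>lborel) = (\<integral>\<^sup>+v. (\<integral>\<^sup>+s. indicator {Q v<..<1} s \<partial>lborel) \<partial>lborel)"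
    by (intro nn_integral_cong) (auto simp: max_def)
  also have "\<dots> = (\<integral>\<^sup>+v. (\<integral>\<^sup>+s. indicator {x. Q (fst x) < snd x \<and> snd x < 1} (v, s) \<partial>lborel) \<partial>lborel)"
    by (auto intro!: nn_integral_cong simp: indicator_def)
  also have "\<dots> = (\<integral>\<^sup>+s. (\<integral>\<^sup>+v. indicator {x. Q (fst x) < snd x \<and> snd x < 1} (v, s) \<partial>lborel) \<partial>lborel)"
    by (rule lborel_pair.Fubini') simp
  also have "\<dots> = (\<integral>\<^sup>+s. ennreal (indicator {0<..<1} s * sqrt s ^ DIM('a)) * emeasure lborel {v. Q v < 1} \<partial>lborel)"
  proof (rule nn_integral_cong)
    fix s :: real
    show "(\<integral>\<^sup>+v. indicator {x. Q (fst x) < snd x \<and> snd x < 1} (v, s) \<partial>lborel)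
      = ennreal (indicator {0<..<1} s * sqrt s ^ DIM('a)) * emeasure lborel {v. Q v < 1}"
    proof (cases "0 < s \<and> s < 1")
      case True
      then have "(\<integral>\<^sup>+v. indicator {x. Q (fst x) < snd x \<and> snd x < 1} (v, s) \<partial>lborel) = (\<integral>\<^sup>+v. indicator {v. Q v < s} v \<partial>lborel)"
        by (intro nn_integral_cong) (auto simp: indicator_def)
      also have "\<dots> = emeasure lborel {v. Q v < s}" by (rule nn_integral_indicator) simp
      finally show ?thesis using emeasure_lborel_sublevel_scale[of Q s] hom True by simp
    next
      case False
      have "(\<integral>\<^sup>+v. indicator {x. Q (fst x) < snd x \<and> snd x < 1} (v, s) \<partial>lborel) = (\<integral>\<^sup>+v. 0 \<partial>(lborel::'a measure))"
        using False nn by (intro nn_integral_cong) (auto simp: indicator_def, smt (verit))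
      then show ?thesis using False by auto
    qed
  qed
  also have "\<dots> = (\<integral>\<^sup>+s. ennreal (indicator {0<..<1} s * sqrt s ^ DIM('a)) \<partial>lborel) * emeasure lborel {v. Q v < 1}"
    by (rule nn_integral_multc) simp
  finally show ?thesis .
qed

text \<open>Makes the dimensional constant cancellable: the integrand is at most 1 on the unit
  interval and at least (1/2)^N for \<open>s\<close> above 1/4.\<close>

lemma layer_constant_bounds:
  fixes N :: nat
  defines "\<kappa> \<equiv> (\<integral>\<^sup>+s. ennreal (indicator {0<..<1} s * sqrt s ^ N) \<partial>lborel)"
  shows "\<kappa> \<noteq> 0" "\<kappa> \<noteq> \<infinity>"
proof -
  have "\<kappa> \<le> (\<integral>\<^sup>+s. indicator {0<..<1} (s::real) \<partial>lborel)"
    unfolding \<kappa>_def by (intro nn_integral_mono) (auto simp: indicator_def power_le_one)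
  also have "\<dots> = 1" by simp
  finally show "\<kappa> \<noteq> \<infinity>" by (auto simp: top_unique)
  have "(\<integral>\<^sup>+s. ennreal ((1/2) ^ N) * indicator {1/4<..<1} (s::real) \<partial>lborel) \<le> \<kappa>"
    unfolding \<kappa>_def
  proof (intro nn_integral_mono)
    fix s :: real
    show "ennreal ((1/2) ^ N) * indicator {1/4<..<1} s \<le> ennreal (indicator {0<..<1} s * sqrt s ^ N)"
    proof (cases "1/4 < s \<and> s < 1")
      case True
      have "(1/2) ^ N \<le> sqrt s ^ N"
        using True by (intro power_mono real_le_rsqrt) (auto simp: power2_eq_square)
      then show ?thesis using True by (simp add: ennreal_leI)
    qed auto
  qed
  moreover have "(\<integral>\<^sup>+s. ennreal ((1/2) ^ N) * indicator {1/4<..<1} (s::real) \<partial>lborel) = ennreal ((1/2) ^ N) * ennreal (3/4)"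
    by (subst nn_integral_cmult_indicator) auto
  moreover have "\<dots> \<noteq> 0" by simp
  ultimately show "\<kappa> \<noteq> 0" by (metis le_zero_eq)
qed

lemma integral_odd_under_symmetry:
  fixes h :: "'a::euclidean_space \<Rightarrow> real"
  assumes R: "distr lborel borel R = lborel" "R \<in> borel_measurable borel"
    and h: "h \<in> borel_measurable borel" "\<And>x. h (R x) = - h x"
  shows "integral\<^sup>L lborel h = 0"
proof -
  have "integral\<^sup>L lborel h = integral\<^sup>L (distr lborel borel R) h" by (simp add: R)
  also have "\<dots> = integral\<^sup>L lborel (\<lambda>x. h (R x))" using R h by (subst integral_distr) auto
  also have "\<dots> = - integral\<^sup>L lborel h" by (simp add: h)
  finally show ?thesis by simp
qed

section \<open>Hermitian forms of minimal volume\<close>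

lemma complex_vec_scaleR: "r *\<^sub>R (v :: complex ^ 'n) = of_real r *s v"
  unfolding vec_eq_iff by (auto simp: scaleR_conv_of_real[where 'a = complex])

lemma emeasure_lborel_open_nonzero:
  fixes S :: "'a::euclidean_space set"
  assumes "open S" "S \<noteq> {}"
  shows "emeasure lborel S \<noteq> 0"
proof
  assume "emeasure lborel S = 0"
  then have "S \<in> null_sets lebesgue"
    using assms(1) by (intro null_sets_completionI) (auto simp: null_sets_def)
  then show False using open_not_negligible[OF assms] by (simp add: negligible_iff_null_sets)
qed

lemma hermitian_inner_productD:
  assumes "hermitian_inner_product g"
  shows "g (u + v) w = g u w + g v w" "g (c *s u) v = c * g u v" "g v u = cnj (g u v)"
    "v \<noteq> 0 \<Longrightarrow> 0 < Re (g v v)" "g u (v + w) = g u v + g u w" "g u (c *s v) = cnj c * g u v"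
    "g 0 v = 0" "g v 0 = 0" "Im (g v v) = 0"
proof -
  note * = assms[unfolded hermitian_inner_product_def]
  show a: "g (u + v) w = g u w + g v w" for u v w using * by blast
  show b: "g (c *s u) v = c * g u v" for c u v using * by blast
  show c: "g v u = cnj (g u v)" for u v using * by blast
  show "v \<noteq> 0 \<Longrightarrow> 0 < Re (g v v)" using * by blast
  show "g u (v + w) = g u v + g u w" by (metis a c complex_cnj_add)
  show "g u (c *s v) = cnj c * g u v" by (metis b c complex_cnj_mult)
  show d: "g 0 v = 0" for v using b[of 0 0 v] by simp
  show "g v 0 = 0" by (metis d c complex_cnj_zero)
  show "Im (g v v) = 0" using arg_cong[OF c[of v v], of Im] by simp
qed

context
  fixes g :: "complex ^ 'n \<Rightarrow> complex ^ 'n \<Rightarrow> complex"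
  assumes g: "hermitian_inner_product g"
begin

text \<open>Bilinearity is meant over the reals, where the conjugate-linearity of the second
  argument is invisible.\<close>

lemma hermitian_bounded_bilinear: "bounded_bilinear g"
proof -
  note D = hermitian_inner_productD[OF g]
  have "bilinear g"
    unfolding bilinear_def
    by (auto intro!: linearI simp: D(1,2,5,6) complex_vec_scaleR scaleR_conv_of_real[where 'a = complex])
  then show ?thesis by (simp add: bilinear_conv_bounded_bilinear)
qed

lemmas hermitian_continuous = bounded_bilinear.continuous_on[OF hermitian_bounded_bilinear]

lemma hermitian_form_scaleR: "Re (g (r *\<^sub>R v) (r *\<^sub>R v)) = r\<^sup>2 * Re (g v v)"
  by (simp add: complex_vec_scaleR hermitian_inner_productD(2,6)[OF g] power2_eq_square)

lemma hermitian_form_nonneg: "0 \<le> Re (g v v)"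
  using hermitian_inner_productD(4,7)[OF g, of v] by (cases "v = 0") auto

lemma continuous_on_hermitian_form: "continuous_on S (\<lambda>v. Re (g v v))"
  by (intro continuous_intros hermitian_continuous)

lemma open_unit_ball: "open (unit_ball g)"
  unfolding unit_ball_def by (intro open_Collect_less continuous_on_hermitian_form continuous_intros)

text \<open>By compactness the form has a positive minimum \<open>c\<close> on the Euclidean unit
  sphere, and by homogeneity it is at least \<open>c\<close> times the squared norm.\<close>

lemma bounded_unit_ball: "bounded (unit_ball g)"
proof -
  have "\<exists>x\<in>sphere 0 1. \<forall>y\<in>sphere 0 1. Re (g x x) \<le> Re (g y y)"
    by (rule continuous_attains_inf[OF compact_sphere _ continuous_on_hermitian_form]) simp
  then obtain x where x: "norm x = 1" "\<And>y. norm y = 1 \<Longrightarrow> Re (g x x) \<le> Re (g y y)" by auto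
  define c where "c = Re (g x x)"
  have "x \<noteq> 0" using x(1) by auto
  then have c: "0 < c" using hermitian_inner_productD(4)[OF g] by (simp add: c_def)
  have low: "c * (norm v)\<^sup>2 \<le> Re (g v v)" for v
  proof (cases "v = 0")
    case False
    then have v: "v = norm v *\<^sub>R ((1 / norm v) *\<^sub>R v)" by simp
    have "c \<le> Re (g ((1 / norm v) *\<^sub>R v) ((1 / norm v) *\<^sub>R v))"
      unfolding c_def using False by (intro x(2)) simp
    then have "(norm v)\<^sup>2 * c \<le> (norm v)\<^sup>2 * Re (g ((1 / norm v) *\<^sub>R v) ((1 / norm v) *\<^sub>R v))"
      by (intro mult_left_mono) auto
    also have "\<dots> = Re (g v v)" using hermitian_form_scaleR v by metis
    finally show ?thesis by (simp add: mult.commute)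
  qed (simp add: hermitian_form_nonneg)
  show ?thesis
  proof (rule boundedI)
    fix v assume "v \<in> unit_ball g"
    then have "c * (norm v)\<^sup>2 < 1" using low[of v] by (simp add: unit_ball_def)
    then have "(norm v)\<^sup>2 < 1 / c" using c by (simp add: field_simps)
    then have "(norm v)\<^sup>2 \<le> (sqrt (1 / c))\<^sup>2" using c by simp
    then show "norm v \<le> sqrt (1 / c)" by (rule power2_le_imp_le) (use c in simp)
  qed
qed

lemma zero_in_unit_ball: "0 \<in> unit_ball g"
  by (simp add: unit_ball_def hermitian_inner_productD(7)[OF g])

lemma unit_ball_borel [measurable]: "unit_ball g \<in> sets borel"
  using open_unit_ball by simp

lemma emeasure_unit_ball_finite: "emeasure lborel (unit_ball g) < \<infinity>"
  using bounded_unit_ball by (rule emeasure_bounded_finite)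

lemma emeasure_unit_ball_pos: "emeasure lborel (unit_ball g) \<noteq> 0"
  using emeasure_lborel_open_nonzero[OF open_unit_ball] zero_in_unit_ball by blast

lemma integrable_on_unit_ball:
  fixes \<phi> :: "complex ^ 'n \<Rightarrow> real"
  assumes "continuous_on UNIV \<phi>"
  shows "integrable lborel (\<lambda>v. indicator (unit_ball g) v * \<phi> v)"
proof -
  have "set_integrable lborel (closure (unit_ball g)) \<phi>"
    unfolding set_integrable_def
    by (rule borel_integrable_compact) (use bounded_unit_ball assms in \<open>auto simp: compact_closure intro: continuous_on_subset\<close>)
  then have "set_integrable lborel (unit_ball g) \<phi>"
    by (rule set_integrable_subset) (auto intro: closure_subset[THEN subsetD])
  then show ?thesis by (simp add: set_integrable_def)
qed

text \<open>Expresses the volume of the unit ball, up to a constant common to all forms, as an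
  integral that depends on the form in a comparable way.\<close>

lemma integral_one_minus_form:
  defines "\<kappa> \<equiv> (\<integral>\<^sup>+s. ennreal (indicator {0<..<1} s * sqrt s ^ DIM(complex ^ 'n)) \<partial>lborel)"
  shows "(\<integral>v. indicator (unit_ball g) v * (1 - Re (g v v)) \<partial>lborel)
    = enn2real \<kappa> * measure lborel (unit_ball g)"
proof -
  have [measurable]: "(\<lambda>v. Re (g v v)) \<in> borel_measurable borel"
    by (intro borel_measurable_continuous_onI continuous_on_hermitian_form)
  have "(\<integral>v. indicator (unit_ball g) v * (1 - Re (g v v)) \<partial>lborel) = (\<integral>v. max 0 (1 - Re (g v v)) \<partial>lborel)"
    by (intro Bochner_Integration.integral_cong) (auto simp: unit_ball_def indicator_def)
  also have "\<dots> = enn2real (\<integral>\<^sup>+v. ennreal (max 0 (1 - Re (g v v))) \<partial>lborel)"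
    by (intro integral_eq_nn_integral) auto
  also have "\<dots> = enn2real (\<kappa> * emeasure lborel (unit_ball g))"
    unfolding \<kappa>_def unit_ball_def
    by (subst nn_integral_one_minus_quadratic) (auto simp: hermitian_form_scaleR hermitian_form_nonneg)
  finally show ?thesis by (simp add: enn2real_mult measure_def)
qed

end

section \<open>Orthonormal bases and comparison of volumes\<close>

context
  fixes g :: "complex ^ 'n \<Rightarrow> complex ^ 'n \<Rightarrow> complex" and e :: "'n \<Rightarrow> complex ^ 'n"
  assumes g: "hermitian_inner_product g"
    and on: "\<And>i j. g (e i) (e j) = (if i = j then 1 else 0)"
begin

lemma hermitian_sum_left: "g (\<Sum>i\<in>A. f i) v = (\<Sum>i\<in>A. g (f i) v)" 
  by (induction A rule: infinite_finite_induct) (auto simp: hermitian_inner_productD(1,7)[OF g])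

text \<open>Pairing with \<open>e j\<close> recovers the coordinates, so the linear map
  \<open>L\<close> from coordinates to combinations is injective, hence onto since both sides have
  the same dimension.\<close>

lemma orthonormal_expansion: "v = (\<Sum>i\<in>UNIV. g v (e i) *s e i)"
proof -
  note D = hermitian_inner_productD[OF g]
  define L where "L = (\<lambda>x :: complex ^ 'n. \<Sum>i\<in>UNIV. x $ i *s e i)"
  have gL: "g (L x) (e j) = x $ j" for x j
    by (simp add: L_def hermitian_sum_left D(2) on if_distrib cong: if_cong)
  have "linear L"
    unfolding L_def
    by (rule linearI) (auto simp: sum.distrib vector_sadd_rdistrib complex_vec_scaleR scaleR_conv_of_real
        vec_eq_iff sum_distrib_left mult.assoc)
  moreover have "inj L" by (rule injI) (metis gL vec_eq_iff)
  ultimately have "surj L" by (rule linear_inj_imp_surj)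
  then obtain x where x: "v = L x" by auto
  show ?thesis unfolding x gL by (simp add: L_def)
qed

lemma form_expansion:
  assumes h: "hermitian_inner_product h"
  shows "h v v = (\<Sum>i\<in>UNIV. \<Sum>j\<in>UNIV. g v (e i) * cnj (g v (e j)) * h (e i) (e j))"
proof -
  note D = hermitian_inner_productD[OF h]
  have l: "h (\<Sum>i\<in>A. f i) w = (\<Sum>i\<in>A. h (f i) w)" for A :: "'n set" and f w
    by (induction A rule: infinite_finite_induct) (auto simp: D(1,5,7,8))
  have r: "h w (\<Sum>i\<in>A. f i) = (\<Sum>i\<in>A. h w (f i))" for A :: "'n set" and f w
    by (induction A rule: infinite_finite_induct) (auto simp: D(1,5,7,8))
  have "h v v = h (\<Sum>i\<in>UNIV. g v (e i) *s e i) (\<Sum>j\<in>UNIV. g v (e j) *s e j)"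
    using orthonormal_expansion by metis
  also have "\<dots> = (\<Sum>i\<in>UNIV. \<Sum>j\<in>UNIV. g v (e i) * cnj (g v (e j)) * h (e i) (e j))"
    unfolding l r D(2,6) sum_distrib_left by (subst sum.swap) (simp add: mult_ac)
  finally show ?thesis .
qed

text \<open>\<open>R i\<close> changes the sign of the \<open>i\<close>-th coordinate in the basis
  \<open>e\<close>. It is an involution preserving \<open>g\<close>, so the unit ball of
  \<open>g\<close> is the invariant set that pins down the scaling of Lebesgue measure.\<close>

lemma flip_preserves_lborel:
  defines "R \<equiv> \<lambda>i v. v - (2 * g v (e i)) *s e i"
  shows "distr lborel borel (R i) = lborel" "R i \<in> borel_measurable borel"
    "g (R i v) (e j) = (if i = j then - g v (e j) else g v (e j))" "R i v \<in> unit_ball g \<longleftrightarrow> v \<in> unit_ball g"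
proof -
  note D = hermitian_inner_productD[OF g]
  have Dd: "g (u - c *s w) x = g u x - c * g w x" for u w c x
    using D(1)[of "u - c *s w" "c *s w" x] by (simp add: D(2))
  show x: "g (R i v) (e j) = (if i = j then - g v (e j) else g v (e j))" for i j v
    by (simp add: R_def Dd on)
  have Q: "g (R i v) (R i v) = g v v" for v
    by (subst (1 2) form_expansion[OF g]) (auto simp: x on intro!: sum.cong)
  then show mem: "R i v \<in> unit_ball g \<longleftrightarrow> v \<in> unit_ball g" for v by (simp add: unit_ball_def)
  have lin: "linear (R i)"
    by (rule linearI) (auto simp: R_def D(1,2) complex_vec_scaleR algebra_simps vector_add_ldistrib vector_sadd_rdistrib scaleR_conv_of_real[where 'a = complex])
  then show "R i \<in> borel_measurable borel"
    by (intro borel_measurable_continuous_onI linear_continuous_on) (simp add: linear_conv_bounded_linear)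
  have inv: "R i (R i v) = v" for v
  proof -
    have "R i (R i v) = R i v - (2 * g (R i v) (e i)) *s e i" by (simp only: R_def)
    also have "g (R i v) (e i) = - g v (e i)" by (simp add: x)
    finally have "R i (R i v) = R i v + (2 * g v (e i)) *s e i" by (simp add: vec_eq_iff)
    then show ?thesis by (simp add: R_def)
  qed
  show "distr lborel borel (R i) = lborel"
    by (rule lborel_distr_linear_involution[OF lin inv, of "unit_ball g"])
       (use mem emeasure_unit_ball_finite[OF g] emeasure_unit_ball_pos[OF g] open_unit_ball[OF g] in auto)
qed

text \<open>In the basis \<open>e\<close>, the off-diagonal terms of \<open>h\<close> are odd under
  a sign flip and integrate to 0 over the ball of \<open>g\<close>. The diagonal terms have weights
  h(e_i, e_i) \<le> 1, and with all weights equal to 1 they add up to \<open>g\<close>.\<close>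

lemma integral_form_le_on_ball:
  assumes h: "hermitian_inner_product h" and le: "\<And>i. Re (h (e i) (e i)) \<le> 1"
  shows "(\<integral>v. indicator (unit_ball g) v * Re (h v v) \<partial>lborel) \<le> (\<integral>v. indicator (unit_ball g) v * Re (g v v) \<partial>lborel)"
proof -
  define \<psi> where "\<psi> = (\<lambda>i j v. Re (g v (e i) * cnj (g v (e j)) * h (e i) (e j)))"
  have cont: "continuous_on UNIV (\<psi> i j)" for i j
    unfolding \<psi>_def by (intro continuous_intros hermitian_continuous[OF g])
  have int: "integrable lborel (\<lambda>v. indicator (unit_ball g) v * \<psi> i j v)" for i j
    by (intro integrable_on_unit_ball[OF g] cont)
  have off: "(\<integral>v. indicator (unit_ball g) v * \<psi> i j v \<partial>lborel) = 0" if "i \<noteq> j" for i j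
  proof (rule integral_odd_under_symmetry[OF flip_preserves_lborel(1,2)[of i]])
    show "(\<lambda>v. indicator (unit_ball g) v * \<psi> i j v) \<in> borel_measurable borel"
      using borel_measurable_integrable[OF int] by simp
    fix v
    show "indicator (unit_ball g) (v - (2 * g v (e i)) *s e i) * \<psi> i j (v - (2 * g v (e i)) *s e i)
       = - (indicator (unit_ball g) v * \<psi> i j v)"
      using that by (auto simp: \<psi>_def flip_preserves_lborel indicator_def algebra_simps)
  qed
  have "(\<integral>v. indicator (unit_ball g) v * Re (h v v) \<partial>lborel)
      = (\<integral>v. (\<Sum>i\<in>UNIV. \<Sum>j\<in>UNIV. indicator (unit_ball g) v * \<psi> i j v) \<partial>lborel)"
    by (subst form_expansion[OF h]) (simp add: \<psi>_def sum_distrib_left)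
  also have "\<dots> = (\<Sum>i\<in>UNIV. \<Sum>j\<in>UNIV. \<integral>v. indicator (unit_ball g) v * \<psi> i j v \<partial>lborel)"
    by (simp only: Bochner_Integration.integral_sum Bochner_Integration.integrable_sum int)
  also have "\<dots> = (\<Sum>i\<in>UNIV. \<Sum>j\<in>UNIV. if i = j then \<integral>v. indicator (unit_ball g) v * \<psi> i i v \<partial>lborel else 0)"
    by (rule sum.cong[OF refl], rule sum.cong[OF refl]) (simp add: off)
  also have "\<dots> = (\<Sum>i\<in>UNIV. \<integral>v. indicator (unit_ball g) v * \<psi> i i v \<partial>lborel)" by simp
  also have "\<dots> \<le> (\<Sum>i\<in>UNIV. \<integral>v. indicator (unit_ball g) v * (cmod (g v (e i)))\<^sup>2 \<partial>lborel)"
  proof (intro sum_mono integral_mono int integrable_on_unit_ball[OF g])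
    fix i show "continuous_on UNIV (\<lambda>v. (cmod (g v (e i)))\<^sup>2)"
      by (intro continuous_intros hermitian_continuous[OF g])
    fix v
    have "\<psi> i i v = (cmod (g v (e i)))\<^sup>2 * Re (h (e i) (e i))"
      unfolding \<psi>_def complex_norm_square[symmetric] by simp
    also have "\<dots> \<le> (cmod (g v (e i)))\<^sup>2 * 1" by (intro mult_left_mono le) auto
    finally show "indicator (unit_ball g) v * \<psi> i i v \<le> indicator (unit_ball g) v * (cmod (g v (e i)))\<^sup>2"
      by (simp add: indicator_def)
  qed
  also have "\<dots> = (\<integral>v. (\<Sum>i\<in>UNIV. indicator (unit_ball g) v * (cmod (g v (e i)))\<^sup>2) \<partial>lborel)"
    by (subst Bochner_Integration.integral_sum)
       (auto intro!: integrable_on_unit_ball[OF g] continuous_intros hermitian_continuous[OF g])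
  also have "\<dots> = (\<integral>v. indicator (unit_ball g) v * Re (g v v) \<partial>lborel)"
  proof (rule Bochner_Integration.integral_cong)
    fix v
    have "g v v = (\<Sum>i\<in>UNIV. of_real ((cmod (g v (e i)))\<^sup>2))"
      by (subst form_expansion[OF g]) (simp add: on if_distrib complex_norm_square del: of_real_power cong: if_cong)
    then show "(\<Sum>i\<in>UNIV. indicator (unit_ball g) v * (cmod (g v (e i)))\<^sup>2) = indicator (unit_ball g) v * Re (g v v)"
      by (simp add: sum_distrib_left)
  qed simp
  finally show ?thesis .
qed

text \<open>The integral of \<open>W\<close> is nonnegative and at most a positive multiple of the
  difference of the volumes. In the case of equality \<open>W\<close> vanishes almost everywhere,
  which determines the quadratic form of \<open>h\<close> and, by polarization,
  \<open>h\<close>.\<close>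

lemma orthonormal_ball_minimal:
  assumes h: "hermitian_inner_product h" and le: "\<And>i. Re (h (e i) (e i)) \<le> 1"
  shows "emeasure lborel (unit_ball g) \<le> emeasure lborel (unit_ball h)"
    and "emeasure lborel (unit_ball h) \<le> emeasure lborel (unit_ball g) \<Longrightarrow> h = g"
proof -
  define \<kappa> where "\<kappa> = enn2real (\<integral>\<^sup>+s. ennreal (indicator {0<..<1} s * sqrt s ^ DIM(complex ^ 'n)) \<partial>lborel)"
  have \<kappa>: "0 < \<kappa>" unfolding \<kappa>_def using layer_constant_bounds[of "DIM(complex ^ 'n)"]
    by (simp add: enn2real_positive_iff top.not_eq_extremum zero_less_iff_neq_zero)
  \<comment> \<open>On the ball of \<open>g\<close>, \<open>W\<close> is the negative part of 1 - Re
    (h v v); outside it, the positive part.\<close>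
  define W where "W = (\<lambda>v. indicator (unit_ball h) v * (1 - Re (h v v)) - indicator (unit_ball g) v * (1 - Re (h v v)))"
  have W0: "0 \<le> W v" for v by (auto simp: W_def indicator_def unit_ball_def)
  have c: "continuous_on UNIV (\<lambda>v. 1 - Re (h v v))" "continuous_on UNIV (\<lambda>v. 1 - Re (g v v))"
    "continuous_on UNIV (\<lambda>v. Re (h v v))" "continuous_on UNIV (\<lambda>v. Re (g v v))"
    by (intro continuous_intros continuous_on_hermitian_form h g)+
  note I = integrable_on_unit_ball[OF g] integrable_on_unit_ball[OF h]
  have intW: "integrable lborel W" unfolding W_def by (intro Bochner_Integration.integrable_diff I c)
  have "integral\<^sup>L lborel W = \<kappa> * measure lborel (unit_ball h) - (\<integral>v. indicator (unit_ball g) v * (1 - Re (h v v)) \<partial>lborel)"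
    unfolding W_def by (subst Bochner_Integration.integral_diff) (simp_all add: I c integral_one_minus_form[OF h] \<kappa>_def)
  also have "(\<integral>v. indicator (unit_ball g) v * (1 - Re (h v v)) \<partial>lborel)
     = (\<integral>v. indicator (unit_ball g) v * (1 - Re (g v v)) \<partial>lborel)
       + ((\<integral>v. indicator (unit_ball g) v * Re (g v v) \<partial>lborel) - (\<integral>v. indicator (unit_ball g) v * Re (h v v) \<partial>lborel))"
    by (simp add: I c flip: Bochner_Integration.integral_diff Bochner_Integration.integral_add) (simp add: algebra_simps)
  also have "(\<integral>v. indicator (unit_ball g) v * (1 - Re (g v v)) \<partial>lborel) = \<kappa> * measure lborel (unit_ball g)"
    by (simp add: integral_one_minus_form[OF g] \<kappa>_def)
  finally have main: "integral\<^sup>L lborel W \<le> \<kappa> * (measure lborel (unit_ball h) - measure lborel (unit_ball g))"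
    using integral_form_le_on_ball[OF h le] by (simp add: algebra_simps)
  have em: "emeasure lborel (unit_ball g) = ennreal (measure lborel (unit_ball g))"
    "emeasure lborel (unit_ball h) = ennreal (measure lborel (unit_ball h))"
    using emeasure_unit_ball_finite[OF g] emeasure_unit_ball_finite[OF h]
    by (auto intro!: emeasure_eq_ennreal_measure)
  have "0 \<le> integral\<^sup>L lborel W" using W0 by simp
  then have "0 \<le> measure lborel (unit_ball h) - measure lborel (unit_ball g)"
    using main \<kappa> by (smt (verit) mult_pos_neg)
  then show "emeasure lborel (unit_ball g) \<le> emeasure lborel (unit_ball h)"
    unfolding em by (simp add: ennreal_leI)
  assume "emeasure lborel (unit_ball h) \<le> emeasure lborel (unit_ball g)"
  then have "measure lborel (unit_ball h) \<le> measure lborel (unit_ball g)"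
    unfolding em by simp
  then have "\<kappa> * (measure lborel (unit_ball h) - measure lborel (unit_ball g)) \<le> 0"
    using \<kappa> by (simp add: mult_le_0_iff)
  then have "integral\<^sup>L lborel W = 0" using main \<open>0 \<le> integral\<^sup>L lborel W\<close> by linarith
  then have AE: "AE v in lborel. W v = 0"
    using integral_nonneg_eq_0_iff_AE[OF intW] W0 by simp
  have null: "S = {}" if S: "open S" "\<And>v. v \<in> S \<Longrightarrow> 0 < W v" for S
  proof (rule ccontr)
    assume "S \<noteq> {}"
    then have "emeasure lborel S > 0" using S emeasure_lborel_open_nonzero by (simp add: zero_less_iff_neq_zero)
    moreover have "AE v in lborel. v \<notin> S" using AE by eventually_elim (use S(2) in force)
    then have "emeasure lborel S = 0" using S(1) by (simp add: AE_iff_measurable[where N = S])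
    ultimately show False by simp
  qed
  \<comment> \<open>\<open>W\<close> is positive where one form is below 1 and the other above 1.
    These sets are open, and a nonempty open set has positive measure.\<close>
  have "{v. Re (g v v) < 1} \<inter> {v. 1 < Re (h v v)} = {}"
    by (rule null) (auto intro!: open_Int open_Collect_less c continuous_on_const simp: W_def unit_ball_def)
  then have 1: "Re (h v v) \<le> 1" if "Re (g v v) < 1" for v using that by force
  have "{v. 1 < Re (g v v)} \<inter> {v. Re (h v v) < 1} = {}"
    by (rule null) (auto intro!: open_Int open_Collect_less c continuous_on_const simp: W_def unit_ball_def)
  then have 2: "1 \<le> Re (h v v)" if "1 < Re (g v v)" for v using that by force
  have eq: "Re (h v v) = Re (g v v)" for v
  proof (cases "v = 0")
    case False
    define a b where "a = Re (h v v)" and "b = Re (g v v)"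
    have ab: "0 < a" "0 < b" using False hermitian_inner_productD(4) g h by (auto simp: a_def b_def)
    \<comment> \<open>Scaling \<open>v\<close> by \<open>sqrt r\<close>: a number strictly between
      \<open>a\<close> and \<open>b\<close> would give a multiple of \<open>v\<close> on different
      sides of the level 1 for the two forms.\<close>
    have s1: "r * a \<le> 1" if "r * b < 1" "0 < r" for r
      using 1[of "sqrt r *\<^sub>R v"] that by (simp add: hermitian_form_scaleR g h a_def b_def)
    have s2: "1 \<le> r * a" if "1 < r * b" "0 < r" for r
      using 2[of "sqrt r *\<^sub>R v"] that by (simp add: hermitian_form_scaleR g h a_def b_def)
    have "\<not> a < b"
    proof
      assume "a < b"
      then obtain t where t: "a < t" "t < b" using dense by blast
      then show False using s2[of "1 / t"] ab by (simp add: field_simps)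
    qed
    moreover have "\<not> b < a"
    proof
      assume "b < a"
      then obtain t where t: "b < t" "t < a" using dense by blast
      then show False using s1[of "1 / t"] ab by (simp add: field_simps)
    qed
    ultimately show ?thesis by (simp add: a_def b_def)
  qed (simp add: hermitian_inner_productD(7)[OF g] hermitian_inner_productD(7)[OF h])
  have re: "Re (f u v) = (Re (f (u + v) (u + v)) - Re (f u u) - Re (f v v)) / 2"
    if "hermitian_inner_product f" for f and u v :: "complex ^ 'n"
  proof -
    have "Re (f v u) = Re (f u v)" by (metis hermitian_inner_productD(3)[OF that] cnj.sel(1))
    then show ?thesis by (simp add: hermitian_inner_productD(1,5)[OF that])
  qed
  have Re_eq: "Re (h u v) = Re (g u v)" for u v
    using re[OF g, of u v] re[OF h, of u v] by (simp only: eq)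
  \<comment> \<open>Complex linearity in the first argument reduces imaginary parts to real parts,
    which polarization has already matched.\<close>
  have "Im (f u v) = Re (f (- \<i> *s u) v)" if "hermitian_inner_product f" for f and u v :: "complex ^ 'n"
    by (subst hermitian_inner_productD(2)[OF that]) simp
  then have "Im (h u v) = Im (g u v)" for u v using g h Re_eq by metis
  with Re_eq show "h = g" by (intro ext complex_eqI) auto
qed

end

section \<open>The form at a point of the egg domain\<close>

text \<open>For \<open>r < 1\<close> the disc itself witnesses that \<open>r\<close> times its
  derivative has Kobayashi length at most \<open>r\<close>, so this multiple lies in the indicatrix
  and hence in the ball; then r -> 1.\<close>

lemma disc_deriv_norm_le:
  assumes adm: "admissible D z g" and f: "holomorphic_disc D f" "f 0 = z"
  shows "Re (g (disc_deriv f 0) (disc_deriv f 0)) \<le> 1"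
proof -
  define v where "v = disc_deriv f 0"
  have g: "hermitian_inner_product g" using adm by (simp add: admissible_def)
  have less: "r\<^sup>2 * Re (g v v) < 1" if r: "0 < r" "r < 1" for r :: real
  proof -
    have "kobayashi D z (r *\<^sub>R v) \<le> cmod (of_real r)"
      unfolding kobayashi_def
    proof (rule cInf_lower)
      show "cmod (of_real r) \<in> {cmod l |l. \<exists>f. holomorphic_disc D f \<and> f 0 = z \<and> l *s disc_deriv f 0 = r *\<^sub>R v}"
        using f unfolding v_def complex_vec_scaleR by blast
    qed (auto intro!: bdd_belowI[of _ 0])
    then have "r *\<^sub>R v \<in> unit_ball g"
      using adm r by (auto simp: admissible_def kobayashi_indicatrix_def)
    then show ?thesis by (simp add: unit_ball_def hermitian_form_scaleR[OF g])
  qed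
  have "Re (g v v) \<le> 1"
  proof (rule ccontr)
    assume "\<not> ?thesis"
    then have L1: "1 < Re (g v v)" by simp
    define r where "r = 1 / sqrt (Re (g v v))"
    have "0 < r" "r < 1" "r\<^sup>2 * Re (g v v) = 1" using L1 by (auto simp: r_def power_divide)
    then show False using less[of r] by simp
  qed
  then show ?thesis by (simp add: v_def)
qed

text \<open>Kobayashi length below 1 yields a disc and a factor \<open>l\<close> with |l| < 1 and v
  = l f'(0), so the form at \<open>v\<close> is at most |l|^2.\<close>

lemma indicatrix_subset_unit_ball:
  assumes D: "open D" "z \<in> D" and g: "hermitian_inner_product g"
    and le: "\<And>f. holomorphic_disc D f \<Longrightarrow> f 0 = z \<Longrightarrow> Re (g (disc_deriv f 0) (disc_deriv f 0)) \<le> 1"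
  shows "kobayashi_indicatrix D z \<subseteq> unit_ball g"
proof
  fix v assume "v \<in> kobayashi_indicatrix D z"
  then have K: "kobayashi D z v < 1" by (simp add: kobayashi_indicatrix_def)
  define S where "S = {cmod l | l. \<exists>f. holomorphic_disc D f \<and> f 0 = z \<and> l *s disc_deriv f 0 = v}"
  \<comment> \<open>Extracting an element from an infimum below 1 requires a nonempty set, as the
    real infimum of the empty set carries no information. Small affine discs in the direction
    \<open>v\<close> provide elements.\<close>
  have "S \<noteq> {}"
  proof -
    obtain \<epsilon> where \<epsilon>: "0 < \<epsilon>" "ball z \<epsilon> \<subseteq> D" using D openE by blast
    \<comment> \<open>The summand 1 covers \<open>v = 0\<close>.\<close>
    define t where "t = \<epsilon> / (norm v + 1)"
    have t: "0 < t" "t * norm v \<le> \<epsilon>"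
      using \<epsilon> by (auto simp: t_def field_simps add_pos_nonneg intro!: divide_pos_pos)
    define f where "f = (\<lambda>\<zeta>. z + (of_real t * \<zeta>) *s v)"
    have nrm: "norm (c *s v) = cmod c * norm v" for c
      by (simp add: norm_vec_def norm_mult L2_set_right_distrib)
    have "holomorphic_disc D f"
      unfolding holomorphic_disc_def
    proof (intro conjI allI image_subsetI)
      fix i show "(\<lambda>\<zeta>. f \<zeta> $ i) holomorphic_on ball 0 1"
        unfolding f_def by (simp, intro holomorphic_intros)
      fix \<zeta> :: complex assume \<zeta>: "\<zeta> \<in> ball 0 1"
      have "norm ((of_real t * \<zeta>) *s v) < \<epsilon>"
      proof (cases "v = 0")
        case False
        then have "cmod \<zeta> * (t * norm v) < 1 * (t * norm v)" using \<zeta> t by (intro mult_strict_right_mono) auto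
        moreover have "norm ((of_real t * \<zeta>) *s v) = cmod \<zeta> * (t * norm v)"
          using t by (simp add: nrm norm_mult)
        ultimately show ?thesis using t by linarith
      qed (use \<epsilon> in simp)
      then show "f \<zeta> \<in> D" using \<epsilon> by (auto simp: f_def dist_norm subset_iff)
    qed
    moreover have "f 0 = z" by (simp add: f_def)
    moreover have "disc_deriv f 0 = of_real t *s v"
    proof -
      have "deriv (\<lambda>w. f w $ i) 0 = of_real t * v $ i" for i
        unfolding f_def by (rule DERIV_imp_deriv) (auto intro!: derivative_eq_intros)
      then show ?thesis by (simp add: disc_deriv_def vec_eq_iff)
    qed
    ultimately have "cmod (of_real (1 / t)) \<in> S"
      unfolding S_def using t
      by (intro CollectI exI[of _ "of_real (1 / t)"] conjI refl exI[of _ f]) (auto simp: vec_eq_iff)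
    then show ?thesis by blast
  qed
  then obtain x where "x \<in> S" "x < 1"
    using K cInf_lessD[of S 1] by (auto simp: kobayashi_def S_def)
  then obtain l f where l: "cmod l < 1" and f: "holomorphic_disc D f" "f 0 = z" "v = l *s disc_deriv f 0"
    by (auto simp: S_def)
  let ?w = "disc_deriv f 0"
  have "g v v = of_real ((cmod l)\<^sup>2) * g ?w ?w"
    unfolding f(3) complex_norm_square by (simp add: hermitian_inner_productD(2,6)[OF g])
  then have "Re (g v v) = (cmod l)\<^sup>2 * Re (g ?w ?w)" by simp
  also have "\<dots> \<le> (cmod l)\<^sup>2 * 1" using le[OF f(1,2)] by (intro mult_left_mono) auto
  also have "\<dots> < 1" using l by (simp add: abs_square_less_1)
  finally show "v \<in> unit_ball g" by (simp add: unit_ball_def)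
qed

lemma open_egg_domain: "0 < m \<Longrightarrow> open (egg_domain m k)"
  unfolding egg_domain_def hat_norm_sq_def
  by (intro open_Collect_less continuous_intros continuous_on_powr') auto

section \<open>The Hermitian product of the coordinates other than \<open>k\<close>\<close>

definition hat_prod :: "'n::finite \<Rightarrow> complex ^ 'n \<Rightarrow> complex ^ 'n \<Rightarrow> complex" where
  "hat_prod k u v = (\<Sum>j\<in>UNIV - {k}. u $ j * cnj (v $ j))"

lemma hat_prod_self: "hat_prod k v v = of_real (hat_norm_sq k v)"
  by (simp add: hat_prod_def hat_norm_sq_def complex_norm_square del: of_real_power)

lemma hat_prod_linear:
  "hat_prod k (u + v) w = hat_prod k u w + hat_prod k v w"
  "hat_prod k (c *s u) w = c * hat_prod k u w"
  "hat_prod k w u = cnj (hat_prod k u w)"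
  by (auto simp: hat_prod_def algebra_simps sum.distrib sum_distrib_left)

lemma hat_norm_sq_nonneg: "0 \<le> hat_norm_sq k v"
  by (simp add: hat_norm_sq_def sum_nonneg)

lemma hat_prod_cauchy_schwarz: "(cmod (hat_prod k u v))\<^sup>2 \<le> hat_norm_sq k u * hat_norm_sq k v"
  using cauchy_schwarz_sum_complex[of "UNIV - {k}" "\<lambda>j. u $ j" "\<lambda>j. cnj (v $ j)"]
  by (simp add: hat_prod_def hat_norm_sq_def)

text \<open>Both the numerator of the ball automorphism and its derivative are combinations of this
  shape, with \<open>v\<close> specialized to the base point.\<close>

lemma sum_norm_sq_combination:
  "(\<Sum>j\<in>UNIV - {k}. (cmod (\<alpha> * u $ j + \<beta> * v $ j))\<^sup>2)
   = (cmod \<alpha>)\<^sup>2 * hat_norm_sq k u + 2 * Re (\<alpha> * cnj \<beta> * hat_prod k u v) + (cmod \<beta>)\<^sup>2 * hat_norm_sq k v"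
proof -
  have *: "(cmod (x + y))\<^sup>2 = (cmod x)\<^sup>2 + 2 * Re (x * cnj y) + (cmod y)\<^sup>2" for x y
    by (simp only: cmod_power2) (simp add: power2_eq_square algebra_simps)
  have "(\<Sum>j\<in>UNIV - {k}. (cmod (\<alpha> * u $ j + \<beta> * v $ j))\<^sup>2)
    = (\<Sum>j\<in>UNIV - {k}. (cmod \<alpha>)\<^sup>2 * (cmod (u $ j))\<^sup>2 + 2 * Re (\<alpha> * cnj \<beta> * (u $ j * cnj (v $ j))) + (cmod \<beta>)\<^sup>2 * (cmod (v $ j))\<^sup>2)"
  proof (intro sum.cong refl)
    fix j
    have "\<alpha> * u $ j * cnj (\<beta> * v $ j) = \<alpha> * cnj \<beta> * (u $ j * cnj (v $ j))" by simp
    then show "(cmod (\<alpha> * u $ j + \<beta> * v $ j))\<^sup>2 = (cmod \<alpha>)\<^sup>2 * (cmod (u $ j))\<^sup>2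
        + 2 * Re (\<alpha> * cnj \<beta> * (u $ j * cnj (v $ j))) + (cmod \<beta>)\<^sup>2 * (cmod (v $ j))\<^sup>2"
      using * by (simp only: norm_mult power_mult_distrib)
  qed
  also have "\<dots> = (cmod \<alpha>)\<^sup>2 * hat_norm_sq k u + 2 * Re (\<alpha> * cnj \<beta> * hat_prod k u v) + (cmod \<beta>)\<^sup>2 * hat_norm_sq k v"
    by (simp only: sum.distrib hat_norm_sq_def hat_prod_def sum_distrib_left Re_sum)
  finally show ?thesis .
qed

section \<open>The explicit form at a point of the domain\<close>

locale egg_point =
  fixes m :: real and k :: "'n :: finite" and z :: "complex ^ 'n"
  assumes m: "0 < m" "m < 1/2" and z: "z \<in> egg_domain m k"
begin

definition s where "s = 1 - hat_norm_sq k z"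
definition P where "P = cmod (z $ k) powr (2 * m)"
definition d where "d = s powr (1/m) - (cmod (z $ k))\<^sup>2"
definition \<sigma> where "\<sigma> = sqrt s"
text \<open>The radius of the slice of the domain through \<open>z\<close> in the direction of the
  coordinate \<open>k\<close>.\<close>

definition \<rho> where "\<rho> = s powr (1 / (2 * m))"
text \<open>The radius of the slices through the normalized point (p, 0) in the other coordinate
  directions, since |p|^(2m) = P / s.\<close>

definition c where "c = sqrt (1 - P / s)"

lemma P_nonneg: "0 \<le> P" by (simp add: P_def)
lemma P_less: "P < s" using z by (simp add: egg_domain_def P_def s_def)
lemma s_pos: "0 < s" using P_nonneg P_less by simp
lemma \<sigma>_pos: "0 < \<sigma>" using s_pos by (simp add: \<sigma>_def)
lemma \<sigma>_sq: "\<sigma>\<^sup>2 = s" using s_pos by (simp add: \<sigma>_def)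
lemma \<rho>_pos: "0 < \<rho>" using s_pos by (simp add: \<rho>_def)
lemma \<rho>_sq: "\<rho>\<^sup>2 = s powr (1/m)"
  using s_pos m by (simp add: \<rho>_def power2_eq_square flip: powr_add)
lemma \<rho>_powr: "\<rho> powr (2 * m) = s" using s_pos m by (simp add: \<rho>_def powr_powr)
lemma c_sq: "c\<^sup>2 = 1 - P / s" using P_less s_pos by (simp add: c_def)
lemma c_pos: "0 < c" using P_less s_pos by (simp add: c_def)
lemma c_sq': "s * c\<^sup>2 = s - P" using s_pos by (simp add: c_sq field_simps)

lemma norm_less_\<rho>: "cmod (z $ k) < \<rho>"
proof (rule ccontr)
  assume "\<not> ?thesis"
  then have "\<rho> powr (2 * m) \<le> P" unfolding P_def using m \<rho>_pos by (intro powr_mono2) auto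
  then show False using P_less \<rho>_powr by simp
qed

lemma d_eq: "d = \<rho>\<^sup>2 - (cmod (z $ k))\<^sup>2" by (simp add: d_def \<rho>_sq)
lemma d_pos: "0 < d" using norm_less_\<rho> by (simp add: d_eq power_strict_mono)

text \<open>Up to the factor \<open>\<rho>\<close>, the \<open>k\<close>-th component of the
  differential at \<open>z\<close> of the automorphism taking \<open>z\<close> to (p, 0).\<close>

definition lead where "lead u = u $ k + z $ k * hat_prod k u z / of_real (m * s)"

text \<open>The pullback under that automorphism of |v_1|^2 / (1 - |p|^2)^2 + |v-hat|^2 / (1 -
  |p|^(2m)), written out in the original coordinates.\<close>

definition form where
  "form u v = of_real (\<rho>\<^sup>2 / d\<^sup>2) * lead u * cnj (lead v)
     + of_real (1 / (s - P)) * (hat_prod k u v + hat_prod k u z * cnj (hat_prod k v z) / of_real s)"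

text \<open>\<open>\<Lambda>\<close> and \<open>\<mu>\<close> are the coefficient rows of the
  functionals \<open>lead\<close> and \<open>\<lambda>v. hat_prod k v z\<close>. The matrix is the
  rank-one matrix of the first plus a multiple of the identity off \<open>k\<close> corrected by the
  rank-one matrix of the second.\<close>

lemma wu_coeff_decomposition:
  defines "\<Lambda> \<equiv> \<lambda>i. if i = k then 1 else z $ k * cnj (z $ i) / of_real (m * s)"
    and "\<mu> \<equiv> \<lambda>i. if i = k then 0 else cnj (z $ i)"
  shows "wu_coeff m k z i j = of_real (\<rho>\<^sup>2 / d\<^sup>2) * \<Lambda> i * cnj (\<Lambda> j)
     + of_real (1 / (s - P)) * ((if i = j \<and> i \<noteq> k then 1 else 0) + \<mu> i * cnj (\<mu> j) / of_real s)"
proof -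
  have s1: "s powr (-1 + 1/m) = \<rho>\<^sup>2 / s" and s2: "s powr (-2 + 1/m) = \<rho>\<^sup>2 / s\<^sup>2"
    using s_pos by (simp_all add: \<rho>_sq powr_diff flip: powr_numeral diff_conv_add_uminus add.commute[of "_ :: real"])
  have row: "wu_first_row m k z i = of_real (\<rho>\<^sup>2 / s / (m * d\<^sup>2)) * cnj (z $ k) * z $ i" for i
    by (simp only: wu_first_row_def Let_def s_def[symmetric] s1 d_def[symmetric])
  note nz = s_pos d_pos m P_less
  consider "i = k" "j = k" | "i = k" "j \<noteq> k" | "i \<noteq> k" "j = k" | "i \<noteq> k" "i = j" | "i \<noteq> k" "j \<noteq> k" "i \<noteq> j"
    by blast
  then show ?thesis
  proof cases
    case 1
    then show ?thesis by (simp only: wu_coeff_def Let_def s_def[symmetric] d_def[symmetric]) (simp add: \<Lambda>_def \<mu>_def \<rho>_sq)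
  next
    case 2
    then show ?thesis using nz by (simp add: wu_coeff_def Let_def \<Lambda>_def \<mu>_def row mult_ac)
  next
    case 3
    then show ?thesis using nz by (simp add: wu_coeff_def Let_def \<Lambda>_def \<mu>_def row mult_ac)
  next
    case 4
    then have j: "j \<noteq> k" "i = j" by auto
    have "wu_coeff m k z i j = of_real (\<rho>\<^sup>2 / s\<^sup>2 * (cmod (z $ k))\<^sup>2 * (cmod (z $ j))\<^sup>2 / (m\<^sup>2 * d\<^sup>2)
         + (s + (cmod (z $ j))\<^sup>2) / (s * (s - P)))"
      using j by (simp only: wu_coeff_def Let_def s_def[symmetric] d_def[symmetric] P_def[symmetric] s2) simp
    also have "\<dots> = of_real (\<rho>\<^sup>2 / d\<^sup>2 * ((cmod (z $ k))\<^sup>2 * (cmod (z $ j))\<^sup>2 / (m * s)\<^sup>2) + 1 / (s - P) * (1 + (cmod (z $ j))\<^sup>2 / s))"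
    proof -
      have "(s + x) / (s * (s - P)) = 1 / (s - P) * (1 + x / s)" for x
        using s_pos P_less by (simp add: field_simps)
      then show ?thesis by (simp add: power_mult_distrib mult_ac)
    qed
    also have "\<dots> = of_real (\<rho>\<^sup>2 / d\<^sup>2) * ((z $ k * cnj (z $ k)) * (z $ j * cnj (z $ j)) / of_real ((m * s)\<^sup>2))
       + of_real (1 / (s - P)) * (1 + (z $ j * cnj (z $ j)) / of_real s)"
      by (simp only: of_real_add of_real_mult of_real_divide complex_norm_square of_real_1)
    also have "\<dots> = of_real (\<rho>\<^sup>2 / d\<^sup>2) * \<Lambda> i * cnj (\<Lambda> j)
     + of_real (1 / (s - P)) * ((if i = j \<and> i \<noteq> k then 1 else 0) + \<mu> i * cnj (\<mu> j) / of_real s)"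
      using j by (simp add: \<Lambda>_def \<mu>_def power2_eq_square mult_ac)
    finally show ?thesis .
  next
    case 5
    then have "wu_coeff m k z i j = of_real (\<rho>\<^sup>2 / s\<^sup>2 * (cmod (z $ k))\<^sup>2 / (m\<^sup>2 * d\<^sup>2)) * cnj (z $ i) * z $ j
         + of_real (1 / (s * (s - P))) * cnj (z $ i) * z $ j"
      by (simp only: wu_coeff_def Let_def s_def[symmetric] d_def[symmetric] P_def[symmetric] s2) simp
    also have "\<dots> = of_real (\<rho>\<^sup>2 / d\<^sup>2) * ((z $ k * cnj (z $ k)) / of_real ((m * s)\<^sup>2)) * (cnj (z $ i) * z $ j)
         + of_real (1 / (s - P)) * (cnj (z $ i) * z $ j / of_real s)"
      by (simp only: complex_norm_square[symmetric]) (simp add: power_mult_distrib mult_ac)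
    also have "\<dots> = of_real (\<rho>\<^sup>2 / d\<^sup>2) * \<Lambda> i * cnj (\<Lambda> j)
     + of_real (1 / (s - P)) * ((if i = j \<and> i \<noteq> k then 1 else 0) + \<mu> i * cnj (\<mu> j) / of_real s)"
      using 5 by (simp add: \<Lambda>_def \<mu>_def power2_eq_square mult_ac)
    finally show ?thesis .
  qed
qed

lemma wu_form_eq: "(\<Sum>i\<in>UNIV. \<Sum>j\<in>UNIV. wu_coeff m k z i j * u $ i * cnj (v $ j)) = form u v"
proof -
  define \<Lambda> where "\<Lambda> = (\<lambda>i. if i = k then 1 else z $ k * cnj (z $ i) / of_real (m * s))"
  define M where "M = (\<lambda>i. if i = k then 0 else cnj (z $ i))"
  have split: "(\<Sum>i\<in>UNIV. f i) = f k + (\<Sum>i\<in>UNIV - {k}. f i)" for f :: "'n \<Rightarrow> complex"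
    by (simp add: sum.remove)
  have L: "(\<Sum>i\<in>UNIV. \<Lambda> i * w $ i) = lead w" for w
    by (subst split) (auto simp: \<Lambda>_def lead_def hat_prod_def sum_distrib_left sum_divide_distrib mult_ac intro!: sum.cong)
  have M: "(\<Sum>i\<in>UNIV. M i * w $ i) = hat_prod k w z" for w
    by (subst split) (auto simp: M_def hat_prod_def mult_ac intro!: sum.cong)
  have prod: "(\<Sum>i\<in>UNIV. \<Sum>j\<in>UNIV. a i * cnj (a j) * u $ i * cnj (v $ j)) = (\<Sum>i\<in>UNIV. a i * u $ i) * cnj (\<Sum>j\<in>UNIV. a j * v $ j)" for a :: "'n \<Rightarrow> complex"
    by (simp add: sum_product mult_ac)
  have diag: "(\<Sum>i\<in>UNIV. \<Sum>j\<in>UNIV. (if i = j \<and> i \<noteq> k then 1 else 0) * u $ i * cnj (v $ j)) = hat_prod k u v"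
  proof -
    have *: "(\<Sum>j\<in>UNIV. (if i = j \<and> i \<noteq> k then 1 else 0) * u $ i * cnj (v $ j)) = (if i = k then 0 else u $ i * cnj (v $ i))" for i
    proof -
      have "(\<Sum>j\<in>UNIV. (if i = j \<and> i \<noteq> k then 1 else 0) * u $ i * cnj (v $ j)) = (\<Sum>j\<in>UNIV. if i = j then (if i = k then 0 else u $ i * cnj (v $ j)) else 0)"
        by (intro sum.cong) auto
      then show ?thesis by simp
    qed
    show ?thesis unfolding * by (subst split) (auto simp: hat_prod_def intro!: sum.cong)
  qed
  have "wu_coeff m k z i j * u $ i * cnj (v $ j) = of_real (\<rho>\<^sup>2 / d\<^sup>2) * (\<Lambda> i * cnj (\<Lambda> j) * u $ i * cnj (v $ j))
     + of_real (1 / (s - P)) * ((if i = j \<and> i \<noteq> k then 1 else 0) * u $ i * cnj (v $ j) + M i * cnj (M j) * u $ i * cnj (v $ j) / of_real s)" for i j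
    unfolding wu_coeff_decomposition \<Lambda>_def[symmetric] M_def[symmetric]
    by (simp add: \<Lambda>_def M_def algebra_simps add_divide_distrib)
  then have "(\<Sum>i\<in>UNIV. \<Sum>j\<in>UNIV. wu_coeff m k z i j * u $ i * cnj (v $ j)) =
     of_real (\<rho>\<^sup>2 / d\<^sup>2) * (\<Sum>i\<in>UNIV. \<Sum>j\<in>UNIV. \<Lambda> i * cnj (\<Lambda> j) * u $ i * cnj (v $ j))
     + of_real (1 / (s - P)) * ((\<Sum>i\<in>UNIV. \<Sum>j\<in>UNIV. (if i = j \<and> i \<noteq> k then 1 else 0) * u $ i * cnj (v $ j)) + (\<Sum>i\<in>UNIV. \<Sum>j\<in>UNIV. M i * cnj (M j) * u $ i * cnj (v $ j)) / of_real s)"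
    by (simp only: distrib_left sum.distrib sum_distrib_left sum_divide_distrib)
  then show ?thesis unfolding prod diag L M form_def by (simp add: mult.assoc)
qed

lemma form_self: "Re (form v v) = \<rho>\<^sup>2 / d\<^sup>2 * (cmod (lead v))\<^sup>2
    + 1 / (s - P) * (hat_norm_sq k v + (cmod (hat_prod k v z))\<^sup>2 / s)"
proof -
  have "form v v = of_real (\<rho>\<^sup>2 / d\<^sup>2 * (cmod (lead v))\<^sup>2
    + 1 / (s - P) * (hat_norm_sq k v + (cmod (hat_prod k v z))\<^sup>2 / s))"
    unfolding form_def hat_prod_self by (simp only: of_real_add of_real_mult of_real_divide complex_norm_square mult.assoc)
  then show ?thesis by simp
qed

text \<open>For positivity, a nonzero hat part makes the second term positive; if the hat part is 0,
  then \<open>lead v\<close> is \<open>v $ k\<close>, which is nonzero.\<close>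

lemma form_hermitian: "hermitian_inner_product form"
  unfolding hermitian_inner_product_def
proof (intro conjI allI impI)
  have l: "lead (u + v) = lead u + lead v" "lead (a *s u) = a * lead u" for u v a
    by (auto simp: lead_def hat_prod_linear(1,2) algebra_simps add_divide_distrib)
  show "form (u + v) w = form u w + form v w" for u v w
    by (simp add: form_def l hat_prod_linear(1) algebra_simps add_divide_distrib)
  show "form (a *s u) v = a * form u v" for a u v
    by (simp add: form_def l hat_prod_linear(2) algebra_simps)
  show "form v u = cnj (form u v)" for u v
    by (simp add: form_def hat_prod_linear(3)[of k v u] mult_ac)
  fix v :: "complex ^ 'n" assume "v \<noteq> 0"
  show "0 < Re (form v v)"
  proof (cases "hat_norm_sq k v = 0")
    case True
    then have j: "v $ j = 0" if "j \<noteq> k" for j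
      using that by (simp add: hat_norm_sq_def sum_nonneg_eq_0_iff)
    then have "v $ k \<noteq> 0" using \<open>v \<noteq> 0\<close> by (metis vec_eq_iff zero_index)
    moreover have "lead v = v $ k" using j by (simp add: lead_def hat_prod_def)
    ultimately have "0 < \<rho>\<^sup>2 / d\<^sup>2 * (cmod (lead v))\<^sup>2" using \<rho>_pos d_pos by simp
    moreover have "0 \<le> 1 / (s - P) * (hat_norm_sq k v + (cmod (hat_prod k v z))\<^sup>2 / s)"
      using P_less s_pos hat_norm_sq_nonneg[of k v] by simp
    ultimately show ?thesis unfolding form_self by linarith
  next
    case False
    then have "0 < hat_norm_sq k v" using hat_norm_sq_nonneg[of k v] by simp
    then have "0 < 1 / (s - P) * (hat_norm_sq k v + (cmod (hat_prod k v z))\<^sup>2 / s)"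
      using P_less s_pos by (intro mult_pos_pos add_pos_nonneg) auto
    moreover have "0 \<le> \<rho>\<^sup>2 / d\<^sup>2 * (cmod (lead v))\<^sup>2" by simp
    ultimately show ?thesis unfolding form_self by linarith
  qed
qed

section \<open>The ball automorphism and the bound for all discs\<close>

text \<open>The automorphism of the ball exchanging \<open>0\<close> and \<open>z-hat\<close>; the usual factor \<open>(1 - \<sigma>) / |z-hat|\<^sup>2\<close> of the projection
  to \<open>z-hat\<close> is written \<open>1 / (1 + \<sigma>)\<close>, which also makes sense for \<open>z-hat = 0\<close>.\<close>

definition moeb where
  "moeb v j = (z $ j - of_real \<sigma> * v $ j - hat_prod k v z * z $ j / of_real (1 + \<sigma>)) / (1 - hat_prod k v z)"

text \<open>The classical identity 1 - |phi(v)|^2 = (1 - |a|^2)(1 - |v|^2) / |1 - <v, a>|^2 for the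
  ball automorphism with a = z-hat, where 1 - |a|^2 = s.\<close>

lemma sum_norm_moeb:
  assumes "hat_prod k v z \<noteq> 1"
  shows "(\<Sum>j\<in>UNIV - {k}. (cmod (moeb v j))\<^sup>2) = 1 - s * (1 - hat_norm_sq k v) / (cmod (1 - hat_prod k v z))\<^sup>2"
proof -
  define w where "w = hat_prod k v z"
  \<comment> \<open>Carrying \<open>t\<close> with the relation t (1 + \<sigma>) = 1 keeps the
    identity for the numerators polynomial.\<close>
  define t where "t = 1 / (1 + \<sigma>)"
  have t: "t * (1 + \<sigma>) = 1" using \<sigma>_pos by (simp add: t_def)
  have zz: "hat_norm_sq k z = 1 - \<sigma>\<^sup>2" using \<sigma>_sq by (simp add: s_def)
  have n: "z $ j - of_real \<sigma> * v $ j - w * z $ j / of_real (1 + \<sigma>) = (- of_real \<sigma>) * v $ j + (1 - of_real t * w) * z $ j" for j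
    by (simp add: t_def algebra_simps)
  have "(\<Sum>j\<in>UNIV - {k}. (cmod (moeb v j))\<^sup>2)
    = (\<Sum>j\<in>UNIV - {k}. (cmod ((- of_real \<sigma>) * v $ j + (1 - of_real t * w) * z $ j))\<^sup>2) / (cmod (1 - w))\<^sup>2"
    unfolding moeb_def w_def[symmetric] n by (simp add: norm_divide power_divide sum_divide_distrib)
  also have "(\<Sum>j\<in>UNIV - {k}. (cmod ((- of_real \<sigma>) * v $ j + (1 - of_real t * w) * z $ j))\<^sup>2)
    = (cmod (1 - w))\<^sup>2 - s * (1 - hat_norm_sq k v)"
  proof -
    have A: "(cmod (- complex_of_real \<sigma>))\<^sup>2 = \<sigma>\<^sup>2" by simp
    have B: "(cmod (1 - of_real t * w))\<^sup>2 = 1 - 2 * t * Re w + t\<^sup>2 * (cmod w)\<^sup>2"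
      by (simp only: cmod_power2) (simp add: power2_eq_square algebra_simps)
    have C: "Re (- of_real \<sigma> * cnj (1 - of_real t * w) * w) = - \<sigma> * Re w + \<sigma> * t * (cmod w)\<^sup>2"
      by (simp only: cmod_power2) (simp add: power2_eq_square algebra_simps)
    have D: "(cmod (1 - w))\<^sup>2 = 1 - 2 * Re w + (cmod w)\<^sup>2"
      by (simp only: cmod_power2) (simp add: power2_eq_square algebra_simps)
    have "\<sigma>\<^sup>2 * x + 2 * (- \<sigma> * y + \<sigma> * t * n) + (1 - 2 * t * y + t\<^sup>2 * n) * (1 - \<sigma>\<^sup>2)
      = 1 - 2 * y + n - \<sigma>\<^sup>2 * (1 - x)" for x y n
      using t by algebra
    then show ?thesis unfolding sum_norm_sq_combination A B zz w_def[symmetric] C D \<sigma>_sq[symmetric] by simp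
  qed
  also have "((cmod (1 - w))\<^sup>2 - s * (1 - hat_norm_sq k v)) / (cmod (1 - w))\<^sup>2 = 1 - s * (1 - hat_norm_sq k v) / (cmod (1 - w))\<^sup>2"
    using assms by (simp add: diff_divide_distrib w_def)
  finally show ?thesis by (simp add: w_def)
qed

text \<open>Keeps the base of the complex power away from the branch cut of \<open>Ln\<close>, and
  the denominator of \<open>moeb\<close> away from 0.\<close>

lemma Re_one_minus_hat_prod_pos:
  assumes "hat_norm_sq k v < 1"
  shows "0 < Re (1 - hat_prod k v z)"
proof -
  have "(cmod (hat_prod k v z))\<^sup>2 \<le> hat_norm_sq k v * hat_norm_sq k z" by (rule hat_prod_cauchy_schwarz)
  also have "\<dots> \<le> hat_norm_sq k v * 1"
    using s_pos by (intro mult_left_mono) (auto simp: s_def hat_norm_sq_nonneg)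
  finally have "(cmod (hat_prod k v z))\<^sup>2 < 1" using assms by simp
  then have "cmod (hat_prod k v z) < 1" by (simp add: abs_square_less_1)
  then show ?thesis using complex_Re_le_cmod[of "hat_prod k v z"] by simp
qed

text \<open>The exponential is the principal branch of w^(-1/m); since the exponent is real, its
  modulus depends only on |w|.\<close>

lemma cmod_root_factor:
  assumes "w \<noteq> 0"
  shows "cmod (exp (- (of_real (1 / m) * Ln w))) = cmod w powr (- 1 / m)"
  using assms by (simp add: powr_def)

end

context egg_point begin

lemma exp_Ln_s: "exp (- (of_real (1 / m) * Ln (of_real s))) = of_real (1 / \<rho>\<^sup>2)"
proof -
  have "exp (- (of_real (1 / m) * Ln (of_real s))) = of_real (exp (- (1 / m * ln s)))"
    using s_pos by (simp only: Ln_of_real of_real_mult[symmetric] of_real_minus[symmetric] exp_of_real)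
  also have "exp (- (1 / m * ln s)) = 1 / \<rho>\<^sup>2"
    using s_pos by (simp add: \<rho>_sq powr_def exp_minus inverse_eq_divide)
  finally show ?thesis .
qed

text \<open>The factor w^(-1/m) contributes exactly 1 / |w|^2, the same denominator as in
  \<open>sum_norm_moeb\<close>, so the two terms of the defining inequality combine.\<close>

lemma cmod_root_powr:
  assumes "w \<noteq> 0" "0 \<le> r"
  shows "(r * cmod (exp (- (of_real (1 / m) * Ln w)))) powr (2 * m) = r powr (2 * m) / (cmod w)\<^sup>2"
proof -
  have "(cmod w powr (- 1 / m)) powr (2 * m) = cmod w powr (- 2)" using m by (simp add: powr_powr)
  also have "\<dots> = 1 / (cmod w)\<^sup>2" using assms by (simp add: powr_minus_divide)
  finally show ?thesis unfolding cmod_root_factor[OF assms(1)] using assms by (simp add: powr_mult)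
qed

text \<open>Composing \<open>f\<close> with the automorphism gives a disc (f1, F) in the domain
  through (p, 0). \<open>egg_disc_bound\<close> applies to it, and the chain rule identifies the
  resulting left-hand side with \<open>form\<close>.\<close>

lemma disc_form_le:
  assumes f: "holomorphic_disc (egg_domain m k) f" "f 0 = z"
  shows "Re (form (disc_deriv f 0) (disc_deriv f 0)) \<le> 1"
proof -
  define v where "v = disc_deriv f 0"
  define w where "w = (\<lambda>\<zeta>. hat_prod k (f \<zeta>) z)"
  have hol: "(\<lambda>\<zeta>. f \<zeta> $ i) holomorphic_on ball 0 1" for i using f by (simp add: holomorphic_disc_def)
  have egg: "cmod (f x $ k) powr (2 * m) + hat_norm_sq k (f x) < 1" if "cmod x < 1" for x
    using f that by (auto simp: holomorphic_disc_def egg_domain_def image_subset_iff)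
  have hn: "hat_norm_sq k (f x) < 1" if "cmod x < 1" for x
    using egg[OF that] powr_ge_zero[of "cmod (f x $ k)" "2 * m"] by linarith
  have pos: "0 < Re (1 - w x)" if "cmod x < 1" for x
    unfolding w_def using Re_one_minus_hat_prod_pos[OF hn[OF that]] .
  have nz: "1 - w x \<noteq> 0" if "cmod x < 1" for x using pos[OF that] by auto
  have w_hol: "w holomorphic_on ball 0 1" unfolding w_def hat_prod_def by (intro holomorphic_intros hol)
  define f1 where "f1 = (\<lambda>x. of_real \<rho> * (f x $ k * exp (- (of_real (1 / m) * Ln (1 - w x)))))"
  define F where "F = (\<lambda>j x. moeb (f x) j)"
  have "(cmod (deriv f1 0))\<^sup>2 / (1 - (cmod (f1 0))\<^sup>2)\<^sup>2
       + (\<Sum>i\<in>UNIV - {k}. (cmod (deriv (F i) 0))\<^sup>2) / (1 - cmod (f1 0) powr (2 * m)) \<le> 1"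
  proof (rule egg_disc_bound[OF m])
    show "f1 holomorphic_on ball 0 1"
      unfolding f1_def by (intro holomorphic_intros hol w_hol) (use pos in \<open>force simp: complex_nonpos_Reals_iff\<close>)
    show "F i holomorphic_on ball 0 1" for i
      unfolding F_def moeb_def w_def[symmetric]
      by (intro holomorphic_intros hol w_hol[unfolded w_def]) (use nz \<sigma>_pos in \<open>auto simp: w_def add_eq_0_iff\<close>)
    have zz: "hat_prod k z z = of_real (1 - \<sigma>\<^sup>2)" unfolding hat_prod_self by (simp add: \<sigma>_sq s_def)
    \<comment> \<open>\<open>moeb\<close> vanishes at \<open>z\<close>, because
      \<open>hat_prod k z z\<close> is \<open>1 - \<sigma>\<^sup>2\<close>.\<close>
    have "1 - \<sigma> = (1 - \<sigma>\<^sup>2) / (1 + \<sigma>)" using \<sigma>_pos by (simp add: field_simps power2_eq_square)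
    then have "z $ i - of_real \<sigma> * z $ i - hat_prod k z z * z $ i / of_real (1 + \<sigma>) = 0" for i
      unfolding zz by (metis (no_types, opaque_lifting) diff_self left_diff_distrib mult_1 of_real_1 of_real_diff of_real_divide times_divide_eq_left)
    then show "F i 0 = 0" for i by (simp add: F_def moeb_def f(2))
    fix x :: complex assume x: "cmod x < 1"
    have "cmod (f1 x) = \<rho> * cmod (f x $ k) * cmod (exp (- (of_real (1 / m) * Ln (1 - w x))))"
      using \<rho>_pos by (simp add: f1_def norm_mult)
    then have "cmod (f1 x) powr (2 * m) = (\<rho> * cmod (f x $ k)) powr (2 * m) / (cmod (1 - w x))\<^sup>2"
      using cmod_root_powr[OF nz[OF x], of "\<rho> * cmod (f x $ k)"] \<rho>_pos by simp
    also have "\<dots> = s * cmod (f x $ k) powr (2 * m) / (cmod (1 - w x))\<^sup>2"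
      using \<rho>_pos by (simp add: powr_mult \<rho>_powr)
    finally have f1: "cmod (f1 x) powr (2 * m) = s * cmod (f x $ k) powr (2 * m) / (cmod (1 - w x))\<^sup>2" .
    have Fs: "(\<Sum>i\<in>UNIV - {k}. (cmod (F i x))\<^sup>2) = 1 - s * (1 - hat_norm_sq k (f x)) / (cmod (1 - w x))\<^sup>2"
      unfolding F_def w_def by (rule sum_norm_moeb) (use nz[OF x] in \<open>simp add: w_def\<close>)
    have "s * cmod (f x $ k) powr (2 * m) < s * (1 - hat_norm_sq k (f x))"
      using egg[OF x] s_pos by (intro mult_strict_left_mono) auto
    then have "s * cmod (f x $ k) powr (2 * m) / (cmod (1 - w x))\<^sup>2 < s * (1 - hat_norm_sq k (f x)) / (cmod (1 - w x))\<^sup>2"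
      using nz[OF x] by (intro divide_strict_right_mono) auto
    then show "cmod (f1 x) powr (2 * m) + (\<Sum>i\<in>UNIV - {k}. (cmod (F i x))\<^sup>2) < 1" unfolding f1 Fs by simp
  qed auto
  moreover have w0: "1 - w 0 = of_real s"
    unfolding w_def f(2) hat_prod_self by (simp add: s_def)
  have dv: "((\<lambda>x. f x $ i) has_field_derivative v $ i) (at 0)" for i
    unfolding v_def disc_deriv_def using hol[of i] by (simp, intro holomorphic_derivI[of _ "ball 0 1"]) auto
  have dw: "(w has_field_derivative hat_prod k v z) (at 0)"
    unfolding w_def hat_prod_def by (auto intro!: derivative_eq_intros dv)
  have f10: "f1 0 = z $ k / of_real \<rho>"
    unfolding f1_def w0 exp_Ln_s f(2) using \<rho>_pos by (simp add: power2_eq_square)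
  have df1: "deriv f1 0 = lead v / of_real \<rho>"
  proof (rule DERIV_imp_deriv)
    define E where "E = exp (- (of_real (1 / m) * Ln (1 - w 0)))"
    have E: "E = of_real (1 / \<rho>\<^sup>2)" unfolding E_def w0 exp_Ln_s ..
    have "1 - w 0 \<notin> \<real>\<^sub>\<le>\<^sub>0" unfolding w0 using s_pos by (simp add: complex_nonpos_Reals_iff)
    then have "(f1 has_field_derivative of_real \<rho> * (v $ k * E + z $ k * (E * (of_real (1/m) * (hat_prod k v z / (1 - w 0)))))) (at 0)"
      unfolding f1_def E_def using m(1) s_pos by (auto intro!: derivative_eq_intros dv dw simp: f(2) w0 field_simps)
    moreover have "of_real \<rho> * (v $ k * E + z $ k * (E * (of_real (1/m) * (hat_prod k v z / (1 - w 0))))) = lead v / of_real \<rho>"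
      unfolding E w0 lead_def using \<rho>_pos by (simp add: field_simps power2_eq_square)
    ultimately show "(f1 has_field_derivative lead v / of_real \<rho>) (at 0)" by simp
  qed
  have dF: "deriv (F i) 0 = of_real (- \<sigma> / s) * v $ i + (- hat_prod k v z / of_real ((1 + \<sigma>) * s)) * z $ i" for i
  proof (rule DERIV_imp_deriv)
    define N where "N = (\<lambda>x. z $ i - of_real \<sigma> * f x $ i - w x * z $ i / of_real (1 + \<sigma>))"
    have "1 - \<sigma> = (1 - \<sigma>\<^sup>2) / (1 + \<sigma>)" using \<sigma>_pos by (simp add: field_simps power2_eq_square)
    moreover have "w 0 = of_real (1 - \<sigma>\<^sup>2)" using w0 by (simp add: \<sigma>_sq algebra_simps)
    \<comment> \<open>\<open>F i\<close> is N / (1 - w), so with \<open>N 0 = 0\<close> its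
      derivative at 0 is N'(0) / s.\<close>
    ultimately have N0: "N 0 = 0"
      unfolding N_def f(2) by (metis (no_types, opaque_lifting) diff_self left_diff_distrib mult_1 of_real_1 of_real_diff of_real_divide times_divide_eq_left)
    have dN: "(N has_field_derivative (- (of_real \<sigma> * v $ i) - hat_prod k v z * z $ i / of_real (1 + \<sigma>))) (at 0)"
      unfolding N_def divide_inverse by (auto intro!: derivative_eq_intros dv dw)
    have "((\<lambda>x. N x / (1 - w x)) has_field_derivative (- (of_real \<sigma> * v $ i) - hat_prod k v z * z $ i / of_real (1 + \<sigma>)) / of_real s) (at 0)"
      using s_pos by (auto intro!: derivative_eq_intros dN dw simp: N0 w0)
    moreover have "(\<lambda>x. N x / (1 - w x)) = F i" by (simp add: N_def F_def moeb_def w_def)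
    moreover have "(- (of_real \<sigma> * v $ i) - hat_prod k v z * z $ i / of_real (1 + \<sigma>)) / of_real s = of_real (- \<sigma> / s) * v $ i + (- hat_prod k v z / of_real ((1 + \<sigma>) * s)) * z $ i"
      by (simp add: diff_divide_distrib)
    ultimately show "(F i has_field_derivative of_real (- \<sigma> / s) * v $ i + (- hat_prod k v z / of_real ((1 + \<sigma>) * s)) * z $ i) (at 0)"
      by simp
  qed
  have sF: "(\<Sum>i\<in>UNIV - {k}. (cmod (deriv (F i) 0))\<^sup>2) = (hat_norm_sq k v + (cmod (hat_prod k v z))\<^sup>2 / s) / s"
  proof -
    define W where "W = (cmod (hat_prod k v z))\<^sup>2"
    have zz: "hat_norm_sq k z = 1 - \<sigma>\<^sup>2" using \<sigma>_sq by (simp add: s_def)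
    have "of_real (- \<sigma> / s) * cnj (- hat_prod k v z / of_real ((1 + \<sigma>) * s)) * hat_prod k v z
       = of_real (\<sigma> / s * W / ((1 + \<sigma>) * s))"
      unfolding W_def of_real_mult of_real_divide complex_norm_square by simp
    then have R: "Re (of_real (- \<sigma> / s) * cnj (- hat_prod k v z / of_real ((1 + \<sigma>) * s)) * hat_prod k v z) = \<sigma> / s * W / ((1 + \<sigma>) * s)"
      by (simp only: Re_complex_of_real)
    have A: "(cmod (of_real (- \<sigma> / s)))\<^sup>2 = 1 / s"
      unfolding norm_of_real power2_abs power_divide using \<sigma>_sq s_pos by (simp add: power2_eq_square)
    have B: "(cmod (- hat_prod k v z / of_real ((1 + \<sigma>) * s)))\<^sup>2 = W / ((1 + \<sigma>) * s)\<^sup>2"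
      unfolding W_def norm_divide norm_minus_cancel norm_of_real power_divide power2_abs ..
    have "2 * (\<sigma> / s * W / ((1 + \<sigma>) * s)) + W / ((1 + \<sigma>) * s)\<^sup>2 * (1 - \<sigma>\<^sup>2) = W / s\<^sup>2"
    proof -
      \<comment> \<open>Here a = 1 + \<sigma>, for which 1 - \<sigma>^2 = a (2 - a), so that only
        the nonzero \<open>a\<close> and \<open>s\<close> occur in denominators.\<close>
      have *: "2 * ((a - 1) / s * W / (a * s)) + W / (a * s)\<^sup>2 * (a * (2 - a)) = W / s\<^sup>2" if "a \<noteq> 0" for a
      proof -
        have "2 * ((a - 1) / s * W / (a * s)) = W * (2 * a - 2) / (a * s\<^sup>2)"
          by (simp add: power2_eq_square algebra_simps)
        moreover have "W / (a * s)\<^sup>2 * (a * (2 - a)) = W * (2 - a) / (a * s\<^sup>2)"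
          using that by (simp add: power2_eq_square)
        ultimately have "2 * ((a - 1) / s * W / (a * s)) + W / (a * s)\<^sup>2 * (a * (2 - a))
            = (W * (2 * a - 2) + W * (2 - a)) / (a * s\<^sup>2)"
          by (simp only: add_divide_distrib)
        also have "W * (2 * a - 2) + W * (2 - a) = a * W" by algebra
        finally show ?thesis using that by simp
      qed
      have "(1 + \<sigma>) * (2 - (1 + \<sigma>)) = 1 - \<sigma>\<^sup>2" by algebra
      then show ?thesis using *[of "1 + \<sigma>"] \<sigma>_pos by simp
    qed
    then show ?thesis
      unfolding dF sum_norm_sq_combination R A B zz W_def[symmetric] by (simp add: add_divide_distrib power2_eq_square)
  qed
  have "(cmod (deriv f1 0))\<^sup>2 / (1 - (cmod (f1 0))\<^sup>2)\<^sup>2 = \<rho>\<^sup>2 / d\<^sup>2 * (cmod (lead v))\<^sup>2"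
  proof -
    have "1 - (cmod (f1 0))\<^sup>2 = d / \<rho>\<^sup>2" using \<rho>_pos by (simp add: f10 norm_divide power_divide d_eq field_simps)
    moreover have "(cmod (deriv f1 0))\<^sup>2 = (cmod (lead v))\<^sup>2 / \<rho>\<^sup>2" using \<rho>_pos by (simp add: df1 norm_divide power_divide)
    ultimately show ?thesis using \<rho>_pos by (simp add: power_divide power2_eq_square)
  qed
  moreover have "1 - cmod (f1 0) powr (2 * m) = (s - P) / s"
    using \<rho>_pos s_pos by (simp add: f10 norm_divide powr_divide \<rho>_powr P_def diff_divide_distrib)
  then have "(\<Sum>i\<in>UNIV - {k}. (cmod (deriv (F i) 0))\<^sup>2) / (1 - cmod (f1 0) powr (2 * m))
     = 1 / (s - P) * (hat_norm_sq k v + (cmod (hat_prod k v z))\<^sup>2 / s)"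
    unfolding sF using s_pos by simp
  ultimately show ?thesis unfolding form_self v_def[symmetric] by simp
qed

section \<open>An orthonormal frame of disc derivatives\<close>

text \<open>Derivatives at \<open>0\<close> of two kinds of discs: a disc in the slice through \<open>z\<close> in the direction of the coordinate \<open>k\<close>,
  and the images of linear discs through \<open>(p, 0)\<close> in the other coordinate directions.\<close>

definition frame where
  "frame j = (\<chi> i. if j = k then (if i = k then of_real (d / \<rho>) else 0)
     else if i = k then z $ k * of_real (c / m) * cnj (z $ j)
     else of_real (c * \<sigma>) * ((if i = j then - 1 else 0) + cnj (z $ j) * z $ i / of_real (1 + \<sigma>)))"

lemma hat_prod_frame:
  assumes "j \<noteq> k"
  shows "hat_prod k (frame j) u = of_real (c * \<sigma>) * (- cnj (u $ j) + cnj (z $ j) * hat_prod k z u / of_real (1 + \<sigma>))"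
proof -
  have "hat_prod k (frame j) u = (\<Sum>i\<in>UNIV - {k}. of_real (c * \<sigma>) * ((if i = j then - cnj (u $ i) else 0)
      + cnj (z $ j) * (z $ i * cnj (u $ i)) / of_real (1 + \<sigma>)))"
    unfolding hat_prod_def frame_def using assms by (intro sum.cong refl) (auto simp: algebra_simps)
  also have "\<dots> = of_real (c * \<sigma>) * ((\<Sum>i\<in>UNIV - {k}. if i = j then - cnj (u $ i) else 0)
      + cnj (z $ j) * hat_prod k z u / of_real (1 + \<sigma>))"
    by (simp only: hat_prod_def sum.distrib sum_distrib_left[symmetric] sum_divide_distrib[symmetric])
  finally show ?thesis using assms by simp
qed

lemma hat_prod_frame_k: "hat_prod k (frame k) u = 0"
  by (simp add: hat_prod_def frame_def)

text \<open>Since \<open>hat_prod k z z\<close> divided by 1 + \<sigma> is 1 - \<sigma>, the bracket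
  in \<open>hat_prod_frame\<close> collapses to -\<sigma> times \<open>cnj (z $ j)\<close>.\<close>

lemma hat_prod_frame_z: "j \<noteq> k \<Longrightarrow> hat_prod k (frame j) z = - of_real (c * s) * cnj (z $ j)"
proof -
  assume j: "j \<noteq> k"
  have zz: "hat_prod k z z = of_real (1 - \<sigma>\<^sup>2)" unfolding hat_prod_self by (simp add: \<sigma>_sq s_def)
  have "(1 - \<sigma>\<^sup>2) / (1 + \<sigma>) = 1 - \<sigma>" using \<sigma>_pos by (simp add: field_simps power2_eq_square)
  then have *: "of_real (1 - \<sigma>\<^sup>2) / of_real (1 + \<sigma>) = (1 - of_real \<sigma> :: complex)"
    by (metis of_real_1 of_real_diff of_real_divide)
  have "hat_prod k (frame j) z = of_real (c * \<sigma>) * (- cnj (z $ j) + cnj (z $ j) * (of_real (1 - \<sigma>\<^sup>2) / of_real (1 + \<sigma>)))"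
    unfolding hat_prod_frame[OF j] zz by simp
  also have "\<dots> = - of_real (c * \<sigma>\<^sup>2) * cnj (z $ j)"
    unfolding * by (simp add: algebra_simps power2_eq_square)
  finally show ?thesis by (simp only: \<sigma>_sq)
qed

text \<open>\<open>lead\<close> vanishes on every frame vector except \<open>frame k\<close>, whose
  hat part is 0. For the others, the rank-one term of \<open>form\<close> cancels the part of the
  hat product that is proportional to cnj z_i z_j, leaving a multiple of the identity.\<close>

lemma frame_orthonormal: "form (frame i) (frame j) = (if i = j then 1 else 0)"
proof -
  have lead0: "lead (frame j) = 0" if "j \<noteq> k" for j
    unfolding lead_def hat_prod_frame_z[OF that] using that s_pos m by (simp add: frame_def)
  have leadk: "lead (frame k) = of_real (d / \<rho>)"
    unfolding lead_def hat_prod_frame_k by (simp add: frame_def)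
  consider "i = k" "j = k" | "i = k" "j \<noteq> k" | "i \<noteq> k" "j = k" | "i \<noteq> k" "j \<noteq> k" by blast
  then show ?thesis
  proof cases
    case 1
    have "complex_of_real (\<rho>\<^sup>2 / d\<^sup>2 * (d / \<rho>) * (d / \<rho>)) = 1"
      using d_pos \<rho>_pos by (simp add: power2_eq_square)
    then show ?thesis using 1 by (simp add: form_def leadk hat_prod_frame_k)
  next
    case 2
    then show ?thesis by (simp add: form_def lead0 hat_prod_frame_k)
  next
    case 3
    then show ?thesis by (simp add: form_def lead0 hat_prod_linear(3)[of k _ "frame k"] hat_prod_frame_k)
  next
    case 4
    define Z where "Z = cnj (z $ i) * z $ j"
    have zf: "hat_prod k z (frame j) = - of_real (c * s) * z $ j"
      using 4 by (subst hat_prod_linear(3)) (simp add: hat_prod_frame_z)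
    have fj: "frame j $ i = of_real (c * \<sigma>) * ((if i = j then - 1 else 0) + cnj (z $ j) * z $ i / of_real (1 + \<sigma>))"
      using 4 by (simp add: frame_def)
    have "hat_prod k (frame i) (frame j) = of_real ((c * \<sigma>) * (c * \<sigma>)) * (if i = j then 1 else 0)
       - of_real (c * \<sigma> * ((c * \<sigma> + c * s) / (1 + \<sigma>))) * Z"
      unfolding hat_prod_frame[OF 4(1)] zf fj Z_def by (simp add: algebra_simps add_divide_distrib)
    also have "(c * \<sigma> + c * s) / (1 + \<sigma>) = c * \<sigma>"
      using \<sigma>_pos by (simp add: \<sigma>_sq[symmetric] field_simps power2_eq_square)
    also have "(c * \<sigma>) * (c * \<sigma>) = s - P"
    proof -
      have "(c * \<sigma>) * (c * \<sigma>) = \<sigma>\<^sup>2 * c\<^sup>2" by (simp add: power2_eq_square)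
      then show ?thesis by (simp only: \<sigma>_sq c_sq')
    qed
    finally have h1: "hat_prod k (frame i) (frame j) = of_real (s - P) * (if i = j then 1 else 0) - of_real (s - P) * Z" .
    have "hat_prod k (frame i) z * cnj (hat_prod k (frame j) z) / of_real s = of_real (c * s * (c * s) / s) * Z"
      unfolding hat_prod_frame_z[OF 4(1)] hat_prod_frame_z[OF 4(2)] Z_def by simp
    also have "c * s * (c * s) / s = s - P" using c_sq' s_pos by (simp add: power2_eq_square mult_ac)
    finally have h2: "hat_prod k (frame i) z * cnj (hat_prod k (frame j) z) / of_real s = of_real (s - P) * Z" .
    show ?thesis
      unfolding form_def h1 h2 using 4 P_less by (simp add: lead0)
  qed
qed

text \<open>For \<open>j = k\<close>, a disc automorphism scaled to the slice of radius
  \<open>\<rho>\<close> through \<open>z\<close>. Otherwise, the linear disc x -> (p, c x e_j)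
  carried to \<open>z\<close> by the inverse automorphism; \<open>moeb\<close> itself appears since
  it is an involution.\<close>

lemma frame_is_disc_deriv:
  obtains f where "holomorphic_disc (egg_domain m k) f" "f 0 = z" "disc_deriv f 0 = frame j"
proof (cases "j = k")
  case True
  define p where "p = z $ k / of_real \<rho>"
  have p: "cmod p < 1" using norm_less_\<rho> \<rho>_pos by (simp add: p_def norm_divide)
  have den: "1 + cnj p * x \<noteq> 0" if "cmod x < 1" for x
    using one_minus_cnj_mult_Re_pos[of "- p" x] p that by force
  define f where "f = (\<lambda>x. \<chi> i. if i = k then of_real \<rho> * ((x + p) / (1 + cnj p * x)) else z $ i)"
  have hf: "hat_norm_sq k (f x) = hat_norm_sq k z" for x by (simp add: hat_norm_sq_def f_def)
  have "holomorphic_disc (egg_domain m k) f"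
    unfolding holomorphic_disc_def
  proof (intro conjI allI image_subsetI)
    fix i show "(\<lambda>x. f x $ i) holomorphic_on ball 0 1"
      unfolding f_def using den by (cases "i = k") (auto intro!: holomorphic_intros)
    fix x :: complex assume "x \<in> ball 0 1"
    then have x: "cmod x < 1" by simp
    have "0 < (1 - (cmod p)\<^sup>2) * (1 - (cmod x)\<^sup>2)" using p x by (simp add: abs_square_less_1)
    then have "(cmod (x + p))\<^sup>2 < (cmod (1 + cnj p * x))\<^sup>2"
      using ball_automorphism_norm[of "- p" x] by simp
    then have "cmod (x + p) < cmod (1 + cnj p * x)" by (rule power_less_imp_less_base) simp
    then have "cmod ((x + p) / (1 + cnj p * x)) < 1" using den[OF x] by (simp add: norm_divide)
    then have "\<rho> * cmod ((x + p) / (1 + cnj p * x)) < \<rho> * 1"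
      using \<rho>_pos by (intro mult_strict_left_mono)
    moreover have "cmod (f x $ k) = \<rho> * cmod ((x + p) / (1 + cnj p * x))"
      using \<rho>_pos by (simp add: f_def norm_mult del: times_divide_eq_right)
    ultimately have "cmod (f x $ k) < \<rho>" by simp
    then have "cmod (f x $ k) powr (2 * m) < \<rho> powr (2 * m)" using m by (intro powr_less_mono2) auto
    then show "f x \<in> egg_domain m k" by (simp add: egg_domain_def \<rho>_powr hf s_def)
  qed
  moreover have "f 0 = z" using \<rho>_pos by (simp add: f_def p_def vec_eq_iff)
  moreover have "disc_deriv f 0 = frame j"
  proof -
    have "deriv (\<lambda>x. f x $ i) 0 = frame j $ i" for i
    proof (cases "i = k")
      case i: True
      have "((\<lambda>x. of_real \<rho> * ((x + p) / (1 + cnj p * x))) has_field_derivative of_real \<rho> * (1 - p * cnj p)) (at 0)"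
        by (auto intro!: derivative_eq_intros simp: algebra_simps)
      moreover have "of_real \<rho> * (1 - p * cnj p) = complex_of_real (\<rho> * (1 - (cmod p)\<^sup>2))"
        by (simp only: of_real_mult of_real_diff of_real_1 complex_norm_square)
      moreover have "\<rho> * (1 - (cmod p)\<^sup>2) = d / \<rho>"
        using \<rho>_pos by (simp add: p_def norm_divide power_divide d_eq field_simps power2_eq_square)
      ultimately show ?thesis using i True by (simp add: f_def frame_def DERIV_imp_deriv)
    next
      case False
      then show ?thesis using True by (simp add: f_def frame_def)
    qed
    then show ?thesis by (simp add: disc_deriv_def vec_eq_iff)
  qed
  ultimately show thesis by (rule that)
next
  case j: False
  \<comment> \<open>\<open>W x\<close> is the product of c x e_j with \<open>z\<close>. As c^2 = 1 -
    P / s, the linear disc stays in the domain exactly for |x| < 1.\<close>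
  define W where "W = (\<lambda>x. of_real c * x * cnj (z $ j))"
  define f where "f = (\<lambda>x. \<chi> i. if i = k then z $ k * exp (- (of_real (1 / m) * Ln (1 - W x))) else moeb (axis j (of_real c * x)) i)"
  have hp: "hat_prod k (axis j x) z = x * cnj (z $ j)" for x
  proof -
    have "hat_prod k (axis j x) z = (\<Sum>i\<in>UNIV - {k}. if i = j then x * cnj (z $ j) else 0)"
      unfolding hat_prod_def by (intro sum.cong) (auto simp: axis_def)
    then show ?thesis using j by simp
  qed
  have hnx: "hat_norm_sq k (axis j x) = (cmod x)\<^sup>2" for x
  proof -
    have "hat_norm_sq k (axis j x) = (\<Sum>i\<in>UNIV - {k}. if i = j then (cmod x)\<^sup>2 else 0)"
      unfolding hat_norm_sq_def by (intro sum.cong) (auto simp: axis_def)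
    then show ?thesis using j by simp
  qed
  have c1: "c \<le> 1" using c_sq P_nonneg s_pos by (simp add: c_def)
  have lt: "(cmod (of_real c * x))\<^sup>2 < c\<^sup>2" if "cmod x < 1" for x
    using that c_pos by (simp add: norm_mult power_mult_distrib abs_square_less_1)
  have pos: "0 < Re (1 - W x)" if x: "cmod x < 1" for x
  proof -
    have "c\<^sup>2 \<le> 1" using c1 c_pos by (simp add: abs_square_le_1)
    then have "hat_norm_sq k (axis j (of_real c * x)) < 1" unfolding hnx using lt[OF x] by linarith
    then show ?thesis using Re_one_minus_hat_prod_pos[of "axis j (of_real c * x)"] by (simp only: hp W_def)
  qed
  have nz: "1 - W x \<noteq> 0" if "cmod x < 1" for x using pos[OF that] by auto
  have Ln_ok: "1 - W x \<notin> \<real>\<^sub>\<le>\<^sub>0" if "cmod x < 1" for x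
    using pos[OF that] by (auto simp: complex_nonpos_Reals_iff)
  have fi: "f x $ i = (z $ i - of_real \<sigma> * (if i = j then of_real c * x else 0) - W x * z $ i / of_real (1 + \<sigma>)) / (1 - W x)"
    if "i \<noteq> k" for i x
    using that by (simp add: f_def moeb_def hp W_def) (auto simp: axis_def)
  have \<sigma>1: "1 + complex_of_real \<sigma> \<noteq> 0" using \<sigma>_pos by (metis add_pos_pos less_irrefl of_real_1 of_real_add of_real_eq_0_iff zero_less_one)
  have W_hol: "W holomorphic_on ball 0 1" unfolding W_def by (intro holomorphic_intros)
  have "holomorphic_disc (egg_domain m k) f"
    unfolding holomorphic_disc_def
  proof (intro conjI allI image_subsetI)
    fix i show "(\<lambda>x. f x $ i) holomorphic_on ball 0 1"
    proof (cases "i = k")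
      case True
      then show ?thesis unfolding f_def using Ln_ok by (auto intro!: holomorphic_intros W_hol)
    next
      case False
      show ?thesis unfolding fi[OF False] using nz \<sigma>1
        by (cases "i = j") (auto intro!: holomorphic_intros W_hol)
    qed
    fix x :: complex assume "x \<in> ball 0 1"
    then have x: "cmod x < 1" by simp
    have "cmod (f x $ k) = cmod (z $ k) * cmod (exp (- (of_real (1 / m) * Ln (1 - W x))))"
      by (simp add: f_def norm_mult)
    then have k: "cmod (f x $ k) powr (2 * m) = P / (cmod (1 - W x))\<^sup>2"
      using cmod_root_powr[OF nz[OF x], of "cmod (z $ k)"] by (simp add: P_def)
    have "hat_norm_sq k (f x) = (\<Sum>i\<in>UNIV - {k}. (cmod (moeb (axis j (of_real c * x)) i))\<^sup>2)"
      by (simp add: hat_norm_sq_def f_def)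
    also have "\<dots> = 1 - s * (1 - (cmod (of_real c * x))\<^sup>2) / (cmod (1 - W x))\<^sup>2"
      using nz[OF x] by (subst sum_norm_moeb) (simp_all add: hp hnx W_def)
    finally have h: "hat_norm_sq k (f x) = 1 - s * (1 - (cmod (of_real c * x))\<^sup>2) / (cmod (1 - W x))\<^sup>2" .
    have "s * (cmod (of_real c * x))\<^sup>2 < s * c\<^sup>2" using lt[OF x] s_pos by (intro mult_strict_left_mono) auto
    then have "P < s * (1 - (cmod (of_real c * x))\<^sup>2)" using c_sq' by (simp add: right_diff_distrib)
    then have "P / (cmod (1 - W x))\<^sup>2 < s * (1 - (cmod (of_real c * x))\<^sup>2) / (cmod (1 - W x))\<^sup>2"
      using nz[OF x] by (intro divide_strict_right_mono) auto
    then show "f x \<in> egg_domain m k" unfolding egg_domain_def mem_Collect_eq k h by simp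
  qed
  moreover have "f 0 = z"
  proof -
    have "f 0 $ i = z $ i" for i
    proof (cases "i = k")
      case True
      then show ?thesis by (simp add: f_def W_def)
    next
      case False
      then show ?thesis by (simp add: fi W_def)
    qed
    then show ?thesis by (simp add: vec_eq_iff)
  qed
  moreover have "disc_deriv f 0 = frame j"
  proof -
    have W0: "W 0 = 0" by (simp add: W_def)
    have dW: "(W has_field_derivative of_real c * cnj (z $ j)) (at 0)"
      unfolding W_def by (auto intro!: derivative_eq_intros)
    have "deriv (\<lambda>x. f x $ i) 0 = frame j $ i" for i
    proof (cases "i = k")
      case True
      have "((\<lambda>x. z $ k * exp (- (of_real (1 / m) * Ln (1 - W x)))) has_field_derivative
          z $ k * of_real (c / m) * cnj (z $ j)) (at 0)"
        using m(1) by (auto intro!: derivative_eq_intros dW simp: W0)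
      then show ?thesis using True j by (simp add: f_def frame_def DERIV_imp_deriv)
    next
      case False
      have "((\<lambda>x. f x $ i) has_field_derivative (- (of_real \<sigma> * (if i = j then of_real c else 0))
          - of_real c * cnj (z $ j) * z $ i / of_real (1 + \<sigma>)) + z $ i * (of_real c * cnj (z $ j))) (at 0)"
        unfolding fi[OF False] using \<sigma>1 by (cases "i = j") (auto intro!: derivative_eq_intros dW simp: W0)
      moreover have "(- (of_real \<sigma> * (if i = j then of_real c else 0))
          - of_real c * cnj (z $ j) * z $ i / of_real (1 + \<sigma>)) + z $ i * (of_real c * cnj (z $ j)) = frame j $ i"
      proof -
        have "1 - 1 / (1 + of_real \<sigma>) = of_real \<sigma> / (1 + complex_of_real \<sigma>)" using \<sigma>1 by (simp add: field_simps)
        then have "z $ i * (of_real c * cnj (z $ j)) - of_real c * cnj (z $ j) * z $ i / of_real (1 + \<sigma>)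
            = of_real (c * \<sigma>) * (cnj (z $ j) * z $ i / of_real (1 + \<sigma>))"
          using \<sigma>1 by (simp add: field_simps)
        then show ?thesis using False j by (simp add: frame_def algebra_simps)
      qed
      ultimately show ?thesis by (simp add: DERIV_imp_deriv)
    qed
    then show ?thesis by (simp add: disc_deriv_def vec_eq_iff)
  qed
  ultimately show thesis by (rule that)
qed

section \<open>Admissibility, minimality and uniqueness of the form\<close>

lemma admissible_form: "admissible (egg_domain m k) z form"
  unfolding admissible_def
  using indicatrix_subset_unit_ball[OF open_egg_domain[OF m(1)] z form_hermitian disc_form_le] form_hermitian by blast

lemma admissible_frame_le:
  assumes "admissible (egg_domain m k) z g" shows "Re (g (frame j) (frame j)) \<le> 1"
  using disc_deriv_norm_le[OF assms] frame_is_disc_deriv[of j] by metis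

lemma form_is_wu_metric: "is_wu_metric (egg_domain m k) z form"
  unfolding is_wu_metric_def volume_minimizing_def
proof (intro conjI allI impI admissible_form)
  fix g assume "admissible (egg_domain m k) z g"
  then show "emeasure lborel (unit_ball form) \<le> emeasure lborel (unit_ball g)"
    using orthonormal_ball_minimal(1)[OF form_hermitian frame_orthonormal] admissible_frame_le
    by (simp add: admissible_def)
next
  fix g assume g: "admissible (egg_domain m k) z g \<and>
    (\<forall>g'. admissible (egg_domain m k) z g' \<longrightarrow> emeasure lborel (unit_ball g) \<le> emeasure lborel (unit_ball g'))"
  then show "g = form"
    using orthonormal_ball_minimal(2)[OF form_hermitian frame_orthonormal, of g] admissible_frame_le admissible_form
    by (simp add: admissible_def)
qed

end

theorem theorem2p4:
  fixes m :: real and k :: "'n :: finite" and z :: "complex ^ 'n"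
  assumes "CARD('n) \<ge> 2"
    and "0 < m" and "m < 1/2"
    and "z \<in> egg_domain m k"
  shows "is_wu_metric (egg_domain m k) z
           (\<lambda>u v. \<Sum>i\<in>UNIV. \<Sum>j\<in>UNIV. wu_coeff m k z i j * u $ i * cnj (v $ j))"
proof -
  interpret egg_point m k z using assms by unfold_locales
  show ?thesis unfolding wu_form_eq by (rule form_is_wu_metric)
qed

end
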